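(* Let $1\le m\le n-1$ be integers. A Radon measure $\mu$ on $\mathbb{R}^n$ is carried by $m$-dimensional Lipschitz graphs if and only if for $\mu$-a.e. $x\in\mathbb{R}^n$ there exists a bad cone $X=X(V_x,\alpha_x)$ (with $V_x\in G(n,m)$ and $\alpha_x\in(0,\infty)$) such that $G_{\mu,X}(x)<\infty$.
   Context: Fix integers $1\le m\le n-1$. $G(n,m)$ is the set of $m$-dimensional linear subspaces of $\mathbb{R}^n$ and $V^\perp$ is the orthogonal complement of $V$. $B(x,r)$ and $U(x,r)$ denote closed and open Euclidean balls. Measures. A Radon measure on $\mathbb{R}^n$ is a Borel regular outer measure that is finite on compact sets. For a nonempty family $\mathcal{F}$ of Borel sets, $\mu$ is carried by $\mathcal{F}$ if there exist $F_1,F_2,\dots\in\mathcal{F}$ with $\mu(\mathbb{R}^n\setminus\bigcup_{i=1}^\infty F_i)=0$. Lipschitz graphs. An $m$-dimensional Lipschitz graph is a set $\mathrm{Graph}(f)=\{(x,f(x)):x\in V\}=\{x+f(x):x\in V\}\subseteq V\times V^\perp=\mathbb{R}^n$, where $V\in G(n,m)$ and $f:V\to V^\perp$ is a Lipschitz function. Bad cones. A bad cone is a set $X=X(V,\alpha)=\{x\in\mathbb{R}^n:\operatorname{dist}(x,V)>\alpha\operatorname{dist}(x,V^\perp)\}$ with $V\in G(n,m)$ and $\alpha\in(0,\infty)$. Write $X_x=x+X$ and $X_Q=\bigcup_{x\in Q}X_x$ for nonempty $Q\subseteq\mathbb{R}^n$. Dyadic cubes. A dyadic cube is a half-open cube $Q=\prod_{i=1}^n[j_i2^{-k},(j_i+1)2^{-k})$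 with $k,j_1,\dots,j_n\in\mathbb{Z}$; $\operatorname{side}Q=2^{-k}$ and $x_Q$ is the center of $Q$. Conical defect. For a dyadic cube $Q$ and bad cone $X=X(V,\alpha)$, put $r_{Q,X}=81\sqrt{n}\max(\alpha,1/\alpha)\operatorname{side}Q$ and $A_{Q,X}=X_Q\cap B(x_Q,r_{Q,X})\setminus U(x_Q,r_{Q,X}/3)$. Let $\Delta^*_{Q,X}$ be the set of all dyadic cubes $R$ with $\operatorname{side}R=\operatorname{side}Q$ and $R\cap A_{Q,X}\ne\emptyset$. For a Radon measure $\mu$, set $\mathrm{Defect}(\mu,Q,X)=\sum_{R\in\Delta^*_{Q,X}}\mu(R)/\mu(Q)$ if $\mu(Q)>0$, and $\mathrm{Defect}(\mu,Q,X)=0$ if $\mu(Q)=0$. Conical Dini function. $G_{\mu,X}:\mathbb{R}^n\to[0,\infty]$ is $G_{\mu,X}(x)=\sum_{\operatorname{side}Q\le1}\mathrm{Defect}(\mu,Q,X)\,\chi_Q(x)$, the sum over all dyadic cubes $Q$ of side length at most $1$. *)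

theory Defs
  imports "HOL-Analysis.Analysis"
begin

section \<open>Radon measures and carrying families\<close>

text \<open>
  Radon measures are Borel regular \<^emph>\<open>outer\<close> measures, so they are set functions defined on all
  subsets of the space. In particular, a property holds almost everywhere iff the set of points
  where it fails, measurable or not, has outer measure zero. In the library,
  \<^const>\<open>outer_measure_space\<close> states countable subadditivity for disjoint sequences only; over
  \<^const>\<open>UNIV\<close> and together with monotonicity this gives it for all sequences. The library's
  \<^const>\<open>lambda_system\<close> is the family of Caratheodory measurable sets.
\<close>

definition radon_measure :: "('a::euclidean_space set \<Rightarrow> ennreal) \<Rightarrow> bool" where
  "radon_measure \<mu> \<longleftrightarrow>
     outer_measure_space UNIV \<mu> \<and>
     sets borel \<subseteq> lambda_system UNIV UNIV \<mu> \<and>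
     (\<forall>A. \<exists>B\<in>sets borel. A \<subseteq> B \<and> \<mu> B = \<mu> A) \<and>
     (\<forall>K. compact K \<longrightarrow> \<mu> K < \<infinity>)"

definition carried_by :: "('a set \<Rightarrow> ennreal) \<Rightarrow> 'a set set \<Rightarrow> bool" where
  "carried_by \<mu> \<F> \<longleftrightarrow> (\<exists>F :: nat \<Rightarrow> 'a set. range F \<subseteq> \<F> \<and> \<mu> (UNIV - (\<Union>i. F i)) = 0)"


section \<open>Lipschitz graphs and bad cones\<close>

definition grassmannian :: "nat \<Rightarrow> 'a::euclidean_space set set" where
  "grassmannian m = {V. subspace V \<and> dim V = m}"

text \<open>Only the values of \<open>f\<close> on \<open>V\<close> matter.\<close>

definition lipschitz_graphs :: "nat \<Rightarrow> 'a::euclidean_space set set" where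
  "lipschitz_graphs m =
     {{x + f x | x. x \<in> V} | V f. V \<in> grassmannian m \<and> f ` V \<subseteq> V\<^sup>\<bottom> \<and> (\<exists>L. L-lipschitz_on V f)}"

definition bad_cone :: "'a::euclidean_space set \<Rightarrow> real \<Rightarrow> 'a set" where
  "bad_cone V \<alpha> = {x. infdist x V > \<alpha> * infdist x (V\<^sup>\<bottom>)}"

definition translates :: "'a::ab_group_add set \<Rightarrow> 'a set \<Rightarrow> 'a set" where
  "translates X Q = (\<Union>x\<in>Q. (+) x ` X)"


section \<open>Dyadic cubes\<close>

definition dyadic_cube :: "int \<Rightarrow> int ^ 'n \<Rightarrow> (real ^ 'n) set" where
  "dyadic_cube k j =
     {x. \<forall>i. of_int (j $ i) * 2 powi (- k) \<le> x $ i \<and> x $ i < (of_int (j $ i) + 1) * 2 powi (- k)}"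

definition dyadic_cubes :: "(real ^ 'n) set set" where
  "dyadic_cubes = {dyadic_cube k j | k j. True}"

text \<open>
  The indices \<open>k\<close> and \<open>j\<close> are determined by the cube (\<open>dyadic_cube_eq_iff\<close>
  below), so the following are meaningful for every dyadic cube.
\<close>

definition side :: "(real ^ 'n) set \<Rightarrow> real" where
  "side Q = (THE s. \<exists>k j. Q = dyadic_cube k j \<and> s = 2 powi (- k))"

definition center :: "(real ^ 'n) set \<Rightarrow> real ^ 'n" where
  "center Q = (THE c. \<exists>k j. Q = dyadic_cube k j \<and> c = (\<chi> i. (of_int (j $ i) + 1 / 2) * 2 powi (- k)))"

lemma half_open_box_eqD:
  fixes a b c d :: "real ^ 'n"
  assumes eq: "{x. \<forall>i. a $ i \<le> x $ i \<and> x $ i < b $ i} = {x. \<forall>i. c $ i \<le> x $ i \<and> x $ i < d $ i}"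
    and ab: "\<And>i. a $ i < b $ i" and cd: "\<And>i. c $ i < d $ i"
  shows "a = c" "b = d"
proof -
  have iff: "(\<forall>i. a $ i \<le> x $ i \<and> x $ i < b $ i) \<longleftrightarrow> (\<forall>i. c $ i \<le> x $ i \<and> x $ i < d $ i)" for x
    using eq by blast
  have "c $ i \<le> a $ i" "a $ i \<le> c $ i" for i
    using iff[of a] iff[of c] ab cd by auto
  then show ac: "a = c"
    by (auto simp: vec_eq_iff intro: antisym)
  have "b $ i = d $ i" for i
  proof (rule ccontr)
    assume ne: "b $ i \<noteq> d $ i"
    define x where "x = (\<chi> k. if k = i then min (b $ i) (d $ i) else a $ k)"
    have *: "x $ i = min (b $ i) (d $ i)" "\<And>k. k \<noteq> i \<Longrightarrow> x $ k = a $ k"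
      by (auto simp: x_def)
    have "a $ i \<le> x $ i"
      using ab[of i] cd[of i] ac * by auto
    then have "(\<forall>k. a $ k \<le> x $ k \<and> x $ k < b $ k) \<longleftrightarrow> x $ i < b $ i"
      "(\<forall>k. c $ k \<le> x $ k \<and> x $ k < d $ k) \<longleftrightarrow> x $ i < d $ i"
      using * ab cd ac by (metis order_refl)+
    with iff[of x] *(1) ne show False
      by auto
  qed
  then show "b = d"
    by (simp add: vec_eq_iff)
qed

lemma dyadic_cube_eq_iff:
  fixes j j' :: "int ^ 'n"
  shows "dyadic_cube k j = dyadic_cube k' j' \<longleftrightarrow> k = k' \<and> j = j'"
proof
  assume eq: "dyadic_cube k j = dyadic_cube k' j'"
  define lo hi :: "int \<Rightarrow> int ^ 'n \<Rightarrow> real ^ 'n"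
    where "lo = (\<lambda>k j. \<chi> i. of_int (j $ i) * 2 powi (- k))"
      and "hi = (\<lambda>k j. \<chi> i. (of_int (j $ i) + 1) * 2 powi (- k))"
  have box: "dyadic_cube k j = {x. \<forall>i. lo k j $ i \<le> x $ i \<and> x $ i < hi k j $ i}" for k j
    by (simp add: dyadic_cube_def lo_def hi_def)
  have diff: "hi k j $ i - lo k j $ i = 2 powi (- k)" for k j i
    by (simp add: lo_def hi_def algebra_simps)
  have less: "lo k j $ i < hi k j $ i" for k j i
    by (simp add: lo_def hi_def)
  have lo: "lo k j = lo k' j'" and hi: "hi k j = hi k' j'"
    using half_open_box_eqD[OF eq[unfolded box] less less] by auto
  have "(2::real) powi (- k) = 2 powi (- k')"
    using diff[of k j] diff[of k' j'] lo hi by metis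
  then have k: "k = k'"
    using power_int_strict_increasing[of "-k" "-k'" "2::real"]
      power_int_strict_increasing[of "-k'" "-k" "2::real"] by linarith
  moreover have "j $ i = j' $ i" for i
    using arg_cong[OF lo, of "\<lambda>v. v $ i"] k by (simp add: lo_def)
  ultimately show "k = k' \<and> j = j'"
    by (simp add: vec_eq_iff)
qed simp

lemma side_dyadic_cube: "side (dyadic_cube k j) = 2 powi (- k)"
  by (auto simp: side_def dyadic_cube_eq_iff)

lemma center_dyadic_cube:
  "center (dyadic_cube k j) = (\<chi> i. (of_int (j $ i) + 1 / 2) * 2 powi (- k))"
  by (auto simp: center_def dyadic_cube_eq_iff)


section \<open>Conical defect and conical Dini function\<close>

text \<open>All notions attached to the bad cone \<open>X(V,\<alpha>)\<close> take \<open>V\<close> and \<open>\<alpha>\<close> as arguments.\<close>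

definition defect_radius :: "(real ^ 'n) set \<Rightarrow> real \<Rightarrow> real" where
  "defect_radius Q \<alpha> = 81 * sqrt (real CARD('n)) * max \<alpha> (1 / \<alpha>) * side Q"

definition conical_annulus :: "(real ^ 'n) set \<Rightarrow> (real ^ 'n) set \<Rightarrow> real \<Rightarrow> (real ^ 'n) set" where
  "conical_annulus Q V \<alpha> =
     translates (bad_cone V \<alpha>) Q \<inter> cball (center Q) (defect_radius Q \<alpha>)
       - ball (center Q) (defect_radius Q \<alpha> / 3)"

definition defect_cubes :: "(real ^ 'n) set \<Rightarrow> (real ^ 'n) set \<Rightarrow> real \<Rightarrow> (real ^ 'n) set set" where
  "defect_cubes Q V \<alpha> = {R \<in> dyadic_cubes. side R = side Q \<and> R \<inter> conical_annulus Q V \<alpha> \<noteq> {}}"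

definition conical_defect ::
    "((real ^ 'n) set \<Rightarrow> ennreal) \<Rightarrow> (real ^ 'n) set \<Rightarrow> (real ^ 'n) set \<Rightarrow> real \<Rightarrow> ennreal" where
  "conical_defect \<mu> Q V \<alpha> =
     (if \<mu> Q > 0 then \<Sum>\<^sub>\<infinity>R\<in>defect_cubes Q V \<alpha>. \<mu> R / \<mu> Q else 0)"

definition conical_dini ::
    "((real ^ 'n) set \<Rightarrow> ennreal) \<Rightarrow> (real ^ 'n) set \<Rightarrow> real \<Rightarrow> real ^ 'n \<Rightarrow> ennreal" where
  "conical_dini \<mu> V \<alpha> x =
     (\<Sum>\<^sub>\<infinity>Q\<in>{Q \<in> dyadic_cubes. side Q \<le> 1}. conical_defect \<mu> Q V \<alpha> * indicator Q x)"

end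

theory Submission
  imports Defs
begin

text \<open>
  Both directions rest on the fact that a bad cone at a point of an \<open>m\<close>-dimensional Lipschitz graph
  misses the graph if the cone is narrow enough, and that conversely a set is contained in such a graph if it
  misses the bad cones at all of its points. The Dini function adds up, over the dyadic cubes around \<open>x\<close>, the mass
  of the cone in an annulus at the scale of the cube, relative to the mass of the cube.

  Suppose that \<open>\<mu>\<close> is carried by graphs. On a graph \<open>\<Gamma>\<close> with constant \<open>L\<close>, take the cone with \<open>\<alpha> = 4 * L\<close>.
  Integrating the Dini function over a bounded part of \<open>\<Gamma>\<close> cancels the denominators and leaves the sum of the masses
  of all annular regions that belong to cubes meeting \<open>\<Gamma>\<close>. Such a region is at a distance from \<open>\<Gamma>\<close> comparable
  to the side of the cube (\<open>graph_point_dist_defect_cubes\<close>). So these regions overlap boundedly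
  (\<open>defect_cubes_overlap\<close>), the integral is finite, and the Dini function is finite almost everywhere on \<open>\<Gamma>\<close>.

  Suppose that the Dini function is finite almost everywhere. Up to a countable decomposition, the cone is
  fixed (\<open>carried_of_finite_dini\<close>) and the Dini function is bounded by a number \<open>n\<close> on a set \<open>A\<close> in a unit
  cube. Most points of \<open>A\<close> are only in cubes in which \<open>A\<close> has a density bounded below
  (\<open>emeasure_low_density_points\<close>). For these cubes, the bound \<open>n\<close> makes the masses of the
  annular regions summable, so by Borel-Cantelli almost every point avoids all of them from some generation on
  (\<open>AE_eventually_notin_dense\<close>). Sets of points with a common such generation then miss the cones at their points
  at small scales (\<open>AE_covered_by_eventually_avoiding\<close>, \<open>diff_notin_bad_cone\<close>), and their pieces of small
  diameter are contained in Lipschitz graphs (\<open>subset_lipschitz_graph\<close>).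
\<close>

section \<open>The Borel measure of a Radon outer measure\<close>

text \<open>
  Every Borel set is Caratheodory measurable, so \<open>\<mu>\<close> is countably additive on the Borel
  sets and can be replaced by a measure \<open>M\<close> there. Borel regularity puts an arbitrary \<open>\<mu>\<close>-null
  set into a Borel null set, so that null sets of \<open>\<mu>\<close>, measurable or not, are exactly what
  \<open>AE x in M\<close> ignores.
\<close>

lemma radon_measure_obtain_borel:
  fixes \<mu> :: "'a::euclidean_space set \<Rightarrow> ennreal"
  assumes "radon_measure \<mu>"
  obtains M :: "'a measure" where "sets M = sets borel"
    and "\<And>A. A \<in> sets borel \<Longrightarrow> emeasure M A = \<mu> A"
    and "\<And>P. (AE x in M. P x) \<longleftrightarrow> \<mu> {x. \<not> P x} = 0"
    and "\<And>A. bounded A \<Longrightarrow> emeasure M A < \<infinity>"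
proof -
  have om: "outer_measure_space UNIV \<mu>" and sub: "sets borel \<subseteq> lambda_system UNIV UNIV \<mu>"
    and reg: "\<And>A. \<exists>B\<in>sets borel. A \<subseteq> B \<and> \<mu> B = \<mu> A"
    and fin: "\<And>K. compact K \<Longrightarrow> \<mu> K < \<infinity>"
    using assms by (auto simp: radon_measure_def)
  \<comment> \<open>Caratheodory's lemma is stated in the context of a sigma-algebra, here the power set.\<close>
  interpret sigma_algebra UNIV "UNIV :: 'a set set"
    by (metis Pow_UNIV sigma_algebra_Pow)
  have ms: "measure_space UNIV (lambda_system UNIV UNIV \<mu>) \<mu>"
    by (rule caratheodory_lemma[OF om])
  define M where "M = measure_of UNIV (sets (borel :: 'a measure)) \<mu>"
  have sets: "sets M = sets borel"
    by (simp add: M_def sets.sigma_sets_eq[of borel, simplified])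
  have pos: "positive (sets M) \<mu>"
    using om by (auto simp: outer_measure_space_def positive_def)
  have ca: "countably_additive (sets M) \<mu>"
    using ms sub unfolding sets measure_space_def countably_additive_def by blast
  have em: "emeasure M A = \<mu> A" if "A \<in> sets borel" for A
    by (rule emeasure_measure_of[OF M_def _ pos ca]) (use that sets in auto)
  have mono: "\<mu> A \<le> \<mu> B" if "A \<subseteq> B" for A B
    using om that by (auto simp: outer_measure_space_def increasing_def)
  have space: "space M = UNIV" by (simp add: M_def)
  have ae: "(AE x in M. P x) \<longleftrightarrow> \<mu> {x. \<not> P x} = 0" for P
  proof
    assume "AE x in M. P x"
    then obtain N where "N \<in> null_sets M" "{x. \<not> P x} \<subseteq> N"
      using space by (auto simp: eventually_ae_filter)
    then show "\<mu> {x. \<not> P x} = 0"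
      using mono[of "{x. \<not> P x}" N] em[of N] sets by (auto simp: null_sets_def)
  next
    assume "\<mu> {x. \<not> P x} = 0"
    with reg[of "{x. \<not> P x}"] obtain B where "B \<in> sets borel" "{x. \<not> P x} \<subseteq> B" "\<mu> B = 0"
      by auto
    then show "AE x in M. P x"
      using em[of B] sets by (intro AE_I[of _ _ B]) auto
  qed
  have bd: "emeasure M A < \<infinity>" if "bounded A" for A
  proof -
    have c: "compact (closure A)" using that by (simp add: compact_closure)
    have "emeasure M A \<le> emeasure M (closure A)"
      by (rule emeasure_mono) (use sets closure_subset in auto)
    also have "\<dots> < \<infinity>" using em[of "closure A"] fin[OF c] by auto
    finally show ?thesis .
  qed
  show ?thesis using that[OF sets em ae bd] by blast
qed

section \<open>Sums of ratios along refining partitions\<close>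

text \<open>
  The inequality survives the degenerate quotients \<open>a / 0\<close> and \<open>a / \<infinity>\<close>, so cells of measure
  zero need no separate treatment in the next lemma.
\<close>

lemma ennreal_divide_times_le: "(a::ennreal) / b * b \<le> a"
proof (cases "b = 0 \<or> b = top")
  case False
  then show ?thesis by (simp add: ennreal_divide_times ennreal_divide_self less_top)
qed auto

text \<open>
  Integrating the sum of the ratios over the cells with index in \<open>J k\<close> cancels each denominator
  against the measure of its cell. What remains is \<open>\<Sum>\<^sub>k \<Sum>\<^sub>j\<^sub>\<in>\<^sub>J\<^sub>k M (D k j)\<close>, which is
  finite if the sets \<open>D k j\<close> overlap boundedly inside a set of finite measure. A function with
  finite integral is finite almost everywhere.
\<close>

lemma AE_summable_ratio_of_finite_overlap:
  fixes c :: "nat \<Rightarrow> 'a \<Rightarrow> nat" and D :: "nat \<Rightarrow> nat \<Rightarrow> 'a set"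
  assumes c [measurable]: "\<And>k. c k \<in> measurable M (count_space UNIV)"
    and D [measurable]: "\<And>k j. D k j \<in> sets M"
    and overlap: "\<And>y. y \<in> space M \<Longrightarrow>
      (\<Sum>k. \<Sum>j. indicator (J k) j * indicator (D k j) y) \<le> ennreal K * indicator B y"
    and B: "B \<in> sets M" "emeasure M B < \<infinity>"
  shows "AE x in M. (\<forall>k. c k x \<in> J k) \<longrightarrow>
    (\<Sum>k. emeasure M (D k (c k x)) / emeasure M {y \<in> space M. c k y = c k x}) < \<infinity>"
proof -
  define r where "r k j = emeasure M (D k j) / emeasure M {y \<in> space M. c k y = j}" for k j
  define h where "h x = (\<Sum>k. \<Sum>j. indicator (J k) j * (r k j * indicator {y \<in> space M. c k y = j} x))" for x
  have h_meas: "h \<in> borel_measurable M"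
    unfolding h_def by measurable
  have "(\<integral>\<^sup>+x. h x \<partial>M) = (\<Sum>k. \<Sum>j. indicator (J k) j * (r k j * emeasure M {y \<in> space M. c k y = j}))"
    unfolding h_def by (simp add: nn_integral_suminf nn_integral_cmult)
  also have "\<dots> \<le> (\<Sum>k. \<Sum>j. indicator (J k) j * emeasure M (D k j))"
    unfolding r_def by (intro suminf_le mult_left_mono ennreal_divide_times_le) auto
  also have "\<dots> = (\<integral>\<^sup>+y. (\<Sum>k. \<Sum>j. indicator (J k) j * indicator (D k j) y) \<partial>M)"
    by (simp add: nn_integral_suminf nn_integral_cmult)
  also have "\<dots> \<le> (\<integral>\<^sup>+y. ennreal K * indicator B y \<partial>M)"
    using overlap by (intro nn_integral_mono) auto
  also have "\<dots> < \<infinity>"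
    using B by (simp add: nn_integral_cmult ennreal_mult_less_top)
  finally have "AE x in M. h x \<noteq> \<infinity>"
    using h_meas by (intro nn_integral_PInf_AE) auto
  then show ?thesis
  proof (rule AE_mp, intro AE_I2 impI)
    fix x assume x: "x \<in> space M" "h x \<noteq> \<infinity>" "\<forall>k. c k x \<in> J k"
    have "r k (c k x) = (\<Sum>j. indicator (J k) j * (r k j * indicator {y \<in> space M. c k y = j} x))" for k
    proof -
      have "(\<Sum>j. indicator (J k) j * (r k j * indicator {y \<in> space M. c k y = j} x)) =
         (\<Sum>j\<in>{c k x}. indicator (J k) j * (r k j * indicator {y \<in> space M. c k y = j} x))"
        by (rule suminf_finite) auto
      then show ?thesis using x by simp
    qed
    then have "h x = (\<Sum>k. r k (c k x))"
      unfolding h_def by simp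
    then show "(\<Sum>k. emeasure M (D k (c k x)) / emeasure M {y \<in> space M. c k y = c k x}) < \<infinity>"
      using x by (simp add: r_def less_top)
  qed
qed


lemma emeasure_eq_suminf_cells:
  fixes c :: "'a \<Rightarrow> nat"
  assumes c [measurable]: "c \<in> measurable M (count_space UNIV)" and A [measurable]: "A \<in> sets M"
  shows "emeasure M A = (\<Sum>j. emeasure M (A \<inter> {y \<in> space M. c y = j}))"
proof -
  have "(\<Sum>j. emeasure M (A \<inter> {y \<in> space M. c y = j})) = emeasure M (\<Union>j. A \<inter> {y \<in> space M. c y = j})"
    by (rule suminf_emeasure) (auto simp: disjoint_family_on_def)
  also have "(\<Union>j. A \<inter> {y \<in> space M. c y = j}) = A"
    using sets.sets_into_space[OF A] by auto
  finally show ?thesis by simp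
qed

text \<open>
  A sequence of countable partitions, each refining the previous one, given by measurable
  functions that assign to a point the number of its cell. Unused numbers give empty cells.
\<close>

locale refining_partitions = finite_measure M for M :: "'a measure" +
  fixes c :: "nat \<Rightarrow> 'a \<Rightarrow> nat"
  assumes c_measurable [measurable]: "\<And>k. c k \<in> measurable M (count_space UNIV)"
    and c_refine: "\<And>k x y. c (Suc k) x = c (Suc k) y \<Longrightarrow> c k x = c k y"
begin

definition cell :: "nat \<Rightarrow> nat \<Rightarrow> 'a set" where
  "cell k j = {y \<in> space M. c k y = j}"

lemma cell_sets [measurable]: "cell k j \<in> sets M"
  unfolding cell_def by measurable

lemma c_refine_le:
  assumes "c k x = c k y" "l \<le> k"
  shows "c l x = c l y"
proof -
  have "c (l + i) x = c (l + i) y \<Longrightarrow> c l x = c l y" for i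
    by (induction i) (auto intro: c_refine)
  from this[of "k - l"] assms show ?thesis by simp
qed

text \<open>
  A stopping time argument: the points of \<open>A\<close> that lie in a cell of low density are covered by the
  first such cell around each of them. These cells are disjoint, so their contributions \<open>\<eta> M(cell)\<close>
  add up to at most \<open>\<eta> M(space)\<close>, without a factor for the number of generations.
\<close>

lemma emeasure_low_density_points:
  fixes \<eta> :: ennreal
  assumes A [measurable]: "A \<in> sets M"
  defines "low k x \<equiv> emeasure M (A \<inter> cell k (c k x)) < \<eta> * emeasure M (cell k (c k x))"
  shows "emeasure M {x \<in> A. \<exists>k. low k x} \<le> \<eta> * emeasure M (space M)"
proof -
  define Z where "Z k = {x \<in> space M. low k x \<and> (\<forall>l<k. \<not> low l x)}" for k
  have low_cell: "low l x \<longleftrightarrow> low l y" if "c k x = c k y" "l \<le> k" for l k x y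
    using c_refine_le[OF that] by (simp add: low_def)
  have Z_sets [measurable]: "Z k \<in> sets M" for k
    unfolding Z_def low_def by measurable
  have disj: "disjoint_family Z"
    unfolding disjoint_family_on_def
  proof (intro ballI impI)
    fix k l :: nat assume "k \<noteq> l"
    then show "Z k \<inter> Z l = {}" by (cases "k < l") (auto simp: Z_def)
  qed
  have eq: "{x \<in> A. \<exists>k. low k x} = (\<Union>k. A \<inter> Z k)"
  proof (intro equalityI subsetI)
    fix x assume "x \<in> {x \<in> A. \<exists>k. low k x}"
    then have x: "x \<in> A" "\<exists>k. low k x" by auto
    define k where "k = (LEAST k. low k x)"
    have "low k x" "\<And>l. l < k \<Longrightarrow> \<not> low l x"
      using x(2) unfolding k_def by (auto intro: LeastI dest: not_less_Least)
    then show "x \<in> (\<Union>k. A \<inter> Z k)"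
      using x(1) sets.sets_into_space[OF A] by (auto simp: Z_def)
  qed (auto simp: Z_def)
  \<comment> \<open>\<open>Z k\<close> is a union of cells of generation \<open>k\<close>, all of low density.\<close>
  have "emeasure M (A \<inter> Z k) \<le> \<eta> * emeasure M (Z k)" for k
  proof -
    have cellwise: "emeasure M (A \<inter> Z k \<inter> cell k j) \<le> \<eta> * emeasure M (Z k \<inter> cell k j)" for j
    proof (cases "Z k \<inter> cell k j = {}")
      case True
      then have "A \<inter> Z k \<inter> cell k j = {}" by blast
      then show ?thesis by simp
    next
      case False
      then obtain x where x: "x \<in> Z k" "c k x = j" by (auto simp: cell_def)
      have "cell k j \<subseteq> Z k"
      proof
        fix y assume "y \<in> cell k j"
        then have y: "y \<in> space M" "c k x = c k y" using x by (auto simp: cell_def)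
        have "low l y \<longleftrightarrow> low l x" if "l \<le> k" for l
          using low_cell[OF y(2) that] by simp
        with x(1) y(1) show "y \<in> Z k" by (simp add: Z_def)
      qed
      then have "Z k \<inter> cell k j = cell k j" "A \<inter> Z k \<inter> cell k j = A \<inter> cell k j" by auto
      moreover have "low k x" using x by (simp add: Z_def)
      ultimately show ?thesis using x by (simp add: low_def)
    qed
    have "emeasure M (A \<inter> Z k) = (\<Sum>j. emeasure M (A \<inter> Z k \<inter> cell k j))"
      unfolding cell_def by (rule emeasure_eq_suminf_cells) auto
    also have "\<dots> \<le> (\<Sum>j. \<eta> * emeasure M (Z k \<inter> cell k j))"
      by (intro suminf_le cellwise) auto
    also have "\<dots> = \<eta> * emeasure M (Z k)"
      by (simp add: cell_def emeasure_eq_suminf_cells[OF c_measurable[of k] Z_sets, of k])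
    finally show ?thesis .
  qed
  note Zk = this
  have "emeasure M {x \<in> A. \<exists>k. low k x} \<le> (\<Sum>k. emeasure M (A \<inter> Z k))"
    unfolding eq by (rule emeasure_subadditive_countably) auto
  also have "\<dots> \<le> (\<Sum>k. \<eta> * emeasure M (Z k))"
    by (intro suminf_le Zk) auto
  also have "\<dots> = \<eta> * emeasure M (\<Union>k. Z k)"
    using disj by (simp add: suminf_emeasure image_subset_iff)
  also have "\<dots> \<le> \<eta> * emeasure M (space M)"
    by (intro mult_left_mono emeasure_space) auto
  finally show ?thesis .
qed

definition ratio_sum :: "(nat \<Rightarrow> nat \<Rightarrow> 'a set) \<Rightarrow> 'a \<Rightarrow> ennreal" where
  "ratio_sum D x = (\<Sum>k. emeasure M (D k (c k x)) / emeasure M (cell k (c k x)))"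

lemma ratio_sum_measurable [measurable]: "ratio_sum D \<in> borel_measurable M"
proof -
  have [measurable]: "(\<lambda>x. emeasure M (D k (c k x)) / emeasure M (cell k (c k x))) \<in> borel_measurable M" for k
    by (rule measurable_compose[OF c_measurable[of k]]) simp
  show ?thesis unfolding ratio_sum_def by measurable
qed

text \<open>
  In a cell of density at least \<open>\<eta>\<close>, the ratio \<open>M (D k j) / M (cell k j)\<close> integrated over
  \<open>A \<inter> cell k j\<close> gives at least \<open>\<eta> M (D k j)\<close>. The bound on the sum of ratios over \<open>A\<close> hence
  makes \<open>M (D k j)\<close> summable over all dense cells, and the Borel-Cantelli lemma applies.
\<close>

lemma AE_eventually_notin_dense:
  fixes C \<eta> :: real
  assumes D [measurable]: "\<And>k j. D k j \<in> sets M"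
    and A [measurable]: "A \<in> sets M" and bound: "\<And>x. x \<in> A \<Longrightarrow> ratio_sum D x \<le> ennreal C"
    and \<eta>: "\<eta> > 0"
  defines "dense k j \<equiv> emeasure M (cell k j) > 0 \<and>
      ennreal \<eta> * emeasure M (cell k j) \<le> emeasure M (A \<inter> cell k j)"
  shows "AE y in M. \<forall>\<^sub>F k in sequentially. \<forall>j. dense k j \<longrightarrow> y \<notin> D k j"
proof -
  define W where "W k = (\<Union>j\<in>{j. dense k j}. D k j)" for k
  have W [measurable]: "W k \<in> sets M" for k
    unfolding W_def by auto
  define q where "q k j = emeasure M (D k j) / emeasure M (cell k j)" for k j
  have termwise: "ennreal \<eta> * (indicator {j. dense k j} j * emeasure M (D k j))
      \<le> q k j * emeasure M (A \<inter> cell k j)" for k j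
  proof (cases "dense k j")
    case True
    then have c: "0 < emeasure M (cell k j)" "ennreal \<eta> * emeasure M (cell k j) \<le> emeasure M (A \<inter> cell k j)"
      by (auto simp: dense_def)
    have "emeasure M (D k j) = q k j * emeasure M (cell k j)"
      using c(1) unfolding q_def by (simp add: ennreal_divide_times ennreal_divide_self less_top[symmetric])
    then have "ennreal \<eta> * emeasure M (D k j) = q k j * (ennreal \<eta> * emeasure M (cell k j))"
      by (simp add: mult_ac)
    also have "\<dots> \<le> q k j * emeasure M (A \<inter> cell k j)"
      by (intro mult_left_mono c) auto
    finally show ?thesis using True by simp
  qed auto
  have "ennreal \<eta> * (\<Sum>k. emeasure M (W k)) \<le> ennreal \<eta> * (\<Sum>k. \<Sum>j. indicator {j. dense k j} j * emeasure M (D k j))"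
  proof (intro mult_left_mono suminf_le)
    fix k
    have "W k = (\<Union>j. if dense k j then D k j else {})"
      by (auto simp: W_def)
    then have "emeasure M (W k) \<le> (\<Sum>j. emeasure M (if dense k j then D k j else {}))"
      by (simp only:) (rule emeasure_subadditive_countably, auto)
    also have "\<dots> = (\<Sum>j. indicator {j. dense k j} j * emeasure M (D k j))"
      by (intro suminf_cong) auto
    finally show "emeasure M (W k) \<le> (\<Sum>j. indicator {j. dense k j} j * emeasure M (D k j))" .
  qed auto
  also have "\<dots> = (\<Sum>k. \<Sum>j. ennreal \<eta> * (indicator {j. dense k j} j * emeasure M (D k j)))"
    by simp
  also have "\<dots> \<le> (\<Sum>k. \<Sum>j. q k j * emeasure M (A \<inter> cell k j))"
    by (intro suminf_le termwise) auto
  also have "\<dots> = (\<Sum>k. \<Sum>j. \<integral>\<^sup>+x. q k j * indicator (A \<inter> cell k j) x \<partial>M)"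
    by (simp add: nn_integral_cmult)
  also have "\<dots> = (\<integral>\<^sup>+x. (\<Sum>k. \<Sum>j. q k j * indicator (A \<inter> cell k j) x) \<partial>M)"
    by (simp add: nn_integral_suminf)
  also have "\<dots> \<le> (\<integral>\<^sup>+x. ennreal C \<partial>M)"
  proof (rule nn_integral_mono)
    fix x assume x: "x \<in> space M"
    have "(\<Sum>j. q k j * indicator (A \<inter> cell k j) x) = q k (c k x) * indicator A x" for k
    proof -
      have "(\<Sum>j. q k j * indicator (A \<inter> cell k j) x) = (\<Sum>j\<in>{c k x}. q k j * indicator (A \<inter> cell k j) x)"
        by (rule suminf_finite) (auto simp: cell_def)
      then show ?thesis using x by (auto simp: cell_def indicator_def)
    qed
    then have "(\<Sum>k. \<Sum>j. q k j * indicator (A \<inter> cell k j) x) = ratio_sum D x * indicator A x"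
      by (simp add: q_def ratio_sum_def)
    also have "\<dots> \<le> ennreal C"
      using bound[of x] by (auto simp: indicator_def)
    finally show "(\<Sum>k. \<Sum>j. q k j * indicator (A \<inter> cell k j) x) \<le> ennreal C" .
  qed
  also have "\<dots> < top"
    by (simp add: emeasure_eq_measure ennreal_mult_less_top)
  finally have "(\<Sum>k. emeasure M (W k)) \<noteq> top"
    using \<eta> by (auto simp: ennreal_mult_top)
  then have "summable (\<lambda>k. measure M (W k))"
    by (intro summable_suminf_not_top) (auto simp: emeasure_eq_measure)
  then have "AE y in M. \<forall>\<^sub>F k in sequentially. y \<in> space M - W k"
    by (intro borel_cantelli_AE1) (auto simp: less_top[symmetric])
  then show ?thesis
    by (rule AE_mp) (auto intro!: AE_I2 elim!: eventually_mono simp: W_def)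
qed

text \<open>
  A set \<open>E n p k0\<close> of the cover consists of the points all of whose cells have density at least
  \<open>1 / (p + 1)\<close> in \<open>{ratio_sum \<le> n}\<close> and that avoid \<open>D k j\<close> for all dense cells of generation
  \<open>k \<ge> k0\<close>. If \<open>x\<close> and \<open>y\<close> are in this set, the cell of \<open>x\<close> is dense, so \<open>y\<close> avoids its set \<open>D\<close>.
  Almost every point is in one of these sets: a low density can occur for every \<open>p\<close> on a
  null set only, and the failure to avoid eventually is null by Borel-Cantelli.
\<close>

theorem AE_covered_by_eventually_avoiding:
  assumes D [measurable]: "\<And>k j. D k j \<in> sets M"
  shows "\<exists>E :: nat \<Rightarrow> 'a set. (AE x in M. ratio_sum D x < \<infinity> \<longrightarrow> x \<in> (\<Union>i. E i)) \<and>
    (\<forall>i. \<exists>k0. \<forall>k\<ge>k0. \<forall>x\<in>E i. \<forall>y\<in>E i. y \<notin> D k (c k x))"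
proof -
  define A where "A n = {x \<in> space M. ratio_sum D x \<le> ennreal (real n)}" for n :: nat
  have A [measurable]: "A n \<in> sets M" for n
    unfolding A_def by measurable
  define \<eta> where "\<eta> p = 1 / real (Suc p)" for p :: nat
  define dense where "dense n p k j \<longleftrightarrow> emeasure M (cell k j) > 0 \<and>
      ennreal (\<eta> p) * emeasure M (cell k j) \<le> emeasure M (A n \<inter> cell k j)" for n p k j
  define E where "E n p k0 = {x \<in> space M. (\<forall>k. dense n p k (c k x)) \<and> (\<forall>k\<ge>k0. \<forall>j. dense n p k j \<longrightarrow> x \<notin> D k j)}"
    for n p k0 :: nat
  define F where "F i = (case prod_decode i of (n, i') \<Rightarrow> case prod_decode i' of (p, k0) \<Rightarrow> E n p k0)" for i
  have F: "\<Union>(range F) = (\<Union>n p k0. E n p k0)"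
  proof -
    have "E n p k0 = F (prod_encode (n, prod_encode (p, k0)))" for n p k0
      by (simp add: F_def)
    then show ?thesis by (fastforce simp: F_def split: prod.splits)
  qed
  have pos: "AE x in M. \<forall>k. emeasure M (cell k (c k x)) > 0"
  proof -
    have "AE x in M. \<forall>k j. emeasure M (cell k j) = 0 \<longrightarrow> x \<notin> cell k j"
      unfolding AE_all_countable
    proof (intro allI)
      fix k j
      show "AE x in M. emeasure M (cell k j) = 0 \<longrightarrow> x \<notin> cell k j"
        by (cases "emeasure M (cell k j) = 0") (auto intro!: AE_not_in)
    qed
    then show ?thesis
      by (rule AE_mp) (auto intro!: AE_I2 simp: zero_less_iff_neq_zero cell_def)
  qed
  have bc: "AE y in M. \<forall>n p. \<forall>\<^sub>F k in sequentially. \<forall>j. dense n p k j \<longrightarrow> y \<notin> D k j"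
    unfolding AE_all_countable dense_def
    by (intro allI AE_eventually_notin_dense[where C = "real _"]) (auto simp: A_def \<eta>_def)
  have low: "AE x in M. \<forall>n. x \<in> A n \<longrightarrow> (\<exists>p. \<forall>k. ennreal (\<eta> p) * emeasure M (cell k (c k x)) \<le> emeasure M (A n \<inter> cell k (c k x)))"
    unfolding AE_all_countable
  proof
    fix n
    define B where "B p = {x \<in> A n. \<exists>k. emeasure M (A n \<inter> cell k (c k x)) < ennreal (\<eta> p) * emeasure M (cell k (c k x))}" for p
    have B [measurable]: "B p \<in> sets M" for p
      unfolding B_def by measurable
    have "emeasure M (\<Inter>p. B p) \<le> ennreal (\<eta> p * measure M (space M))" for p
    proof -
      have "emeasure M (\<Inter>p. B p) \<le> emeasure M (B p)"
        by (rule emeasure_mono) auto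
      also have "\<dots> \<le> ennreal (\<eta> p) * emeasure M (space M)"
        unfolding B_def by (rule emeasure_low_density_points) simp
      also have "\<dots> = ennreal (\<eta> p * measure M (space M))"
        unfolding emeasure_eq_measure by (rule ennreal_mult[symmetric]) (auto simp: \<eta>_def)
      finally show ?thesis .
    qed
    moreover have "(\<lambda>p. ennreal (\<eta> p * measure M (space M))) \<longlonglongrightarrow> ennreal (0 * measure M (space M))"
      unfolding \<eta>_def by (intro tendsto_ennrealI tendsto_mult tendsto_const LIMSEQ_inverse_real_of_nat[unfolded inverse_eq_divide])
    ultimately have "emeasure M (\<Inter>p. B p) \<le> ennreal (0 * measure M (space M))"
      by (intro LIMSEQ_le_const) auto
    then have "(\<Inter>p. B p) \<in> null_sets M"
      by (auto simp: null_sets_def)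
    from AE_not_in[OF this]
    show "AE x in M. x \<in> A n \<longrightarrow> (\<exists>p. \<forall>k. ennreal (\<eta> p) * emeasure M (cell k (c k x)) \<le> emeasure M (A n \<inter> cell k (c k x)))"
      by (rule AE_mp) (auto intro!: AE_I2 simp: B_def not_less)
  qed
  have "AE x in M. ratio_sum D x < \<infinity> \<longrightarrow> x \<in> (\<Union>i. F i)"
    using pos bc low AE_space
  proof eventually_elim
    case (elim x)
    show ?case
    proof
      assume fin: "ratio_sum D x < \<infinity>"
      then obtain r where r: "ratio_sum D x = ennreal r"
        by (cases "ratio_sum D x") auto
      have x: "x \<in> space M" using elim by simp
      have "ratio_sum D x \<le> ennreal (real (nat \<lceil>r\<rceil>))"
        unfolding r by (intro ennreal_leI real_nat_ceiling_ge)
      with x have n: "x \<in> A (nat \<lceil>r\<rceil>)" by (simp add: A_def)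
      define n where "n = nat \<lceil>r\<rceil>"
      obtain p where p: "\<And>k. ennreal (\<eta> p) * emeasure M (cell k (c k x)) \<le> emeasure M (A n \<inter> cell k (c k x))"
        using elim(3) n unfolding n_def by blast
      obtain k0 where "\<And>k. k \<ge> k0 \<Longrightarrow> \<forall>j. dense n p k j \<longrightarrow> x \<notin> D k j"
        using elim(2) unfolding eventually_sequentially by metis
      then have "x \<in> E n p k0"
        using x p elim(1) by (auto simp: E_def dense_def)
      then show "x \<in> (\<Union>i. F i)"
        unfolding F by auto
    qed
  qed
  moreover have "\<exists>k0. \<forall>k\<ge>k0. \<forall>x\<in>F i. \<forall>y\<in>F i. y \<notin> D k (c k x)" for i
  proof -
    obtain n i' p k0 where "prod_decode i = (n, i')" "prod_decode i' = (p, k0)"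
      by (meson surj_pair)
    then have "F i = E n p k0" by (simp add: F_def)
    then show ?thesis
      by (intro exI[of _ k0]) (auto simp: E_def)
  qed
  ultimately show ?thesis by blast
qed

end

section \<open>Orthogonal projections and Lipschitz graphs\<close>

definition proj :: "'a::euclidean_space set \<Rightarrow> 'a \<Rightarrow> 'a" where
  "proj V x = (THE y. y \<in> V \<and> x - y \<in> V\<^sup>\<bottom>)"

context
  fixes V :: "'a::euclidean_space set"
  assumes V: "subspace V"
begin

lemma proj_unique:
  assumes "y \<in> V" "x - y \<in> V\<^sup>\<bottom>" shows "proj V x = y"
  unfolding proj_def
proof (rule the_equality)
  fix z assume z: "z \<in> V \<and> x - z \<in> V\<^sup>\<bottom>"
  have "y - z \<in> V" using z assms V by (simp add: subspace_diff)
  moreover have "(x - z) - (x - y) \<in> V\<^sup>\<bottom>"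
    by (rule subspace_diff[OF subspace_orthogonal_comp]) (use z assms in auto)
  then have "y - z \<in> V\<^sup>\<bottom>" by simp
  ultimately have "orthogonal (y - z) (y - z)" by (auto simp: orthogonal_comp_def)
  then show "z = y" by (simp add: orthogonal_self)
qed (use assms in auto)

lemma proj_in [simp]: "proj V x \<in> V" and diff_proj_in_comp [simp]: "x - proj V x \<in> V\<^sup>\<bottom>"
proof -
  obtain y z where "y \<in> span V" "\<And>w. w \<in> span V \<Longrightarrow> orthogonal z w" "x = y + z"
    using orthogonal_subspace_decomp_exists[of V x] by blast
  then have "y \<in> V" "x - y \<in> V\<^sup>\<bottom>"
    using V by (auto simp: span_eq_iff[THEN iffD2] orthogonal_comp_def orthogonal_commute span_base)
  moreover from proj_unique[OF this] have "proj V x = y" .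
  ultimately show "proj V x \<in> V" "x - proj V x \<in> V\<^sup>\<bottom>" by auto
qed

lemma linear_proj: "linear (proj V)"
proof
  show "proj V (x + y) = proj V x + proj V y" for x y
  proof (rule proj_unique)
    have "(x - proj V x) + (y - proj V y) \<in> V\<^sup>\<bottom>"
      by (intro subspace_add subspace_orthogonal_comp diff_proj_in_comp)
    then show "x + y - (proj V x + proj V y) \<in> V\<^sup>\<bottom>" by (simp add: algebra_simps)
  qed (simp add: V subspace_add)
  show "proj V (r *\<^sub>R x) = r *\<^sub>R proj V x" for r x
  proof (rule proj_unique)
    have "r *\<^sub>R (x - proj V x) \<in> V\<^sup>\<bottom>"
      by (intro subspace_scale subspace_orthogonal_comp diff_proj_in_comp)
    then show "r *\<^sub>R x - r *\<^sub>R proj V x \<in> V\<^sup>\<bottom>" by (simp add: algebra_simps)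
  qed (simp add: V subspace_scale)
qed

lemma proj_diff: "proj V (x - y) = proj V x - proj V y"
  by (rule linear_diff[OF linear_proj])

lemma proj_of_comp: "x \<in> V\<^sup>\<bottom> \<Longrightarrow> proj V x = 0"
  by (rule proj_unique) (simp_all add: V subspace_0)

lemma proj_of_mem: "x \<in> V \<Longrightarrow> proj V x = x"
  by (rule proj_unique) (simp_all add: subspace_0 subspace_orthogonal_comp)

lemma inner_comp: "x \<in> V \<Longrightarrow> y \<in> V\<^sup>\<bottom> \<Longrightarrow> x \<bullet> y = 0"
  by (auto simp: orthogonal_comp_def orthogonal_def)

lemma norm_le_add_comp:
  assumes "x \<in> V" "y \<in> V\<^sup>\<bottom>" shows "norm x \<le> norm (x + y)" "norm y \<le> norm (x + y)"
proof -
  have "(norm (x + y))\<^sup>2 = (norm x)\<^sup>2 + (norm y)\<^sup>2"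
    using inner_comp[OF assms] by (simp add: power2_norm_eq_inner inner_add inner_commute)
  then have "(norm x)\<^sup>2 \<le> (norm (x + y))\<^sup>2" "(norm y)\<^sup>2 \<le> (norm (x + y))\<^sup>2" by auto
  then show "norm x \<le> norm (x + y)" "norm y \<le> norm (x + y)"
    by (auto intro: power2_le_imp_le)
qed

lemma norm_proj_le: "norm (proj V x) \<le> norm x"
  using norm_le_add_comp(1)[OF proj_in[of x] diff_proj_in_comp[of x]] by simp

lemma norm_diff_proj_le: "norm (x - proj V x) \<le> norm x"
  using norm_le_add_comp(2)[OF proj_in[of x] diff_proj_in_comp[of x]] by simp

lemma norm_le_proj: "norm x \<le> norm (proj V x) + norm (x - proj V x)"
  using norm_triangle_ineq[of "proj V x" "x - proj V x"] by simp

lemma infdist_subspace: "infdist x V = norm (x - proj V x)"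
proof (rule antisym)
  show "infdist x V \<le> norm (x - proj V x)"
    using infdist_le[OF proj_in, of x x] by (simp add: dist_norm)
  have "norm (x - proj V x) \<le> dist x a" if "a \<in> V" for a
    using norm_le_add_comp(2)[of "proj V x - a" "x - proj V x"] that
    by (simp add: dist_norm V subspace_diff)
  moreover have "V \<noteq> {}" using V subspace_0 by blast
  ultimately show "norm (x - proj V x) \<le> infdist x V"
    by (auto simp: infdist_notempty intro!: cINF_greatest)
qed

lemma infdist_orthogonal_comp: "infdist x (V\<^sup>\<bottom>) = norm (proj V x)"
proof (rule antisym)
  show "infdist x (V\<^sup>\<bottom>) \<le> norm (proj V x)"
    using infdist_le[OF diff_proj_in_comp[of x], of x] by (simp add: dist_norm)
  have "norm (proj V x) \<le> dist x a" if "a \<in> V\<^sup>\<bottom>" for a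
    using norm_le_add_comp(1)[of "proj V x" "x - proj V x - a"] that
    by (simp add: dist_norm subspace_orthogonal_comp subspace_diff)
  moreover have "V\<^sup>\<bottom> \<noteq> {}" using subspace_orthogonal_comp subspace_0 by blast
  ultimately show "norm (proj V x) \<le> infdist x (V\<^sup>\<bottom>)"
    by (auto simp: infdist_notempty intro!: cINF_greatest)
qed

lemma mem_bad_cone_iff: "x \<in> bad_cone V \<alpha> \<longleftrightarrow> norm (x - proj V x) > \<alpha> * norm (proj V x)"
  by (simp add: bad_cone_def infdist_subspace infdist_orthogonal_comp)

lemma open_bad_cone: "open (bad_cone V \<alpha>)"
  unfolding bad_cone_def
  by (intro open_Collect_less continuous_intros)

end

lemma grassmannian_subspace: "V \<in> grassmannian m \<Longrightarrow> subspace V"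
  by (simp add: grassmannian_def)

text \<open>
  McShane's extension: the largest \<open>L\<close>-Lipschitz function below \<open>f\<close> on \<open>A\<close>.
\<close>

lemma lipschitz_extension_real:
  fixes f :: "'a::metric_space \<Rightarrow> real"
  assumes lip: "L-lipschitz_on A f" and "A \<noteq> {}"
  obtains g where "L-lipschitz_on UNIV g" "\<And>x. x \<in> A \<Longrightarrow> g x = f x"
proof
  have L: "L \<ge> 0" using lip by (rule lipschitz_on_nonneg)
  have fl: "\<bar>f x - f y\<bar> \<le> L * dist x y" if "x \<in> A" "y \<in> A" for x y
    using lipschitz_onD[OF lip that] by (simp add: dist_real_def)
  define g where "g x = (INF a\<in>A. f a + L * dist x a)" for x
  obtain a0 where a0: "a0 \<in> A" using assms by auto
  have below: "f a0 - L * dist x a0 \<le> f a + L * dist x a" if "a \<in> A" for x a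
  proof -
    have "L * dist a0 a \<le> L * (dist x a0 + dist x a)"
      by (intro mult_left_mono L) (metis dist_commute dist_triangle)
    then show ?thesis using fl[OF a0 that] by (simp add: distrib_left)
  qed
  have bdd: "bdd_below ((\<lambda>a. f a + L * dist x a) ` A)" for x
    using below by (intro bdd_belowI2)
  have step: "g x \<le> g y + L * dist x y" for x y
  proof -
    have "g x - L * dist x y \<le> f a + L * dist y a" if "a \<in> A" for a
    proof -
      have "g x \<le> f a + L * dist x a"
        unfolding g_def by (rule cINF_lower[OF bdd that])
      also have "L * dist x a \<le> L * (dist x y + dist y a)"
        by (intro mult_left_mono L dist_triangle)
      finally show ?thesis by (simp add: distrib_left)
    qed
    then have "g x - L * dist x y \<le> g y"
      unfolding g_def[of y] using assms by (intro cINF_greatest) auto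
    then show ?thesis by simp
  qed
  show "L-lipschitz_on UNIV g"
  proof (rule lipschitz_onI[OF _ L])
    show "dist (g x) (g y) \<le> L * dist x y" for x y
      using step[of x y] step[of y x] by (simp add: dist_real_def dist_commute abs_le_iff)
  qed
  show "g x = f x" if "x \<in> A" for x
  proof (rule antisym)
    have "f x \<le> f a + L * dist x a" if "a \<in> A" for a
      using fl[OF \<open>x \<in> A\<close> that] by (simp add: abs_le_iff)
    then show "f x \<le> g x"
      unfolding g_def using assms(2) by (intro cINF_greatest) auto
    show "g x \<le> f x"
      using cINF_lower[OF bdd that, of x] by (simp add: g_def)
  qed
qed

text \<open>
  Extending each coordinate separately costs a dimensional factor in the constant, which is harmless
  here since any Lipschitz constant is allowed for a graph.
\<close>

lemma lipschitz_extension: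
  fixes f :: "'a::metric_space \<Rightarrow> 'b::euclidean_space"
  assumes lip: "L-lipschitz_on A f"
  obtains g where "(real DIM('b) * L)-lipschitz_on UNIV g" "\<And>x. x \<in> A \<Longrightarrow> g x = f x"
proof (cases "A = {}")
  case True
  have "(real DIM('b) * L)-lipschitz_on UNIV (\<lambda>x. 0 :: 'b)"
    using lipschitz_on_nonneg[OF lip] by (intro lipschitz_onI) auto
  then show ?thesis using True that by blast
next
  case False
  have "L-lipschitz_on A (\<lambda>x. f x \<bullet> b)" if "b \<in> Basis" for b
  proof (rule lipschitz_onI[OF _ lipschitz_on_nonneg[OF lip]])
    fix x y assume xy: "x \<in> A" "y \<in> A"
    have "dist (f x \<bullet> b) (f y \<bullet> b) = \<bar>(f x - f y) \<bullet> b\<bar>"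
      by (simp add: dist_real_def inner_diff_left)
    also have "\<dots> \<le> norm (f x - f y)" by (rule Basis_le_norm[OF that])
    also have "\<dots> \<le> L * dist x y" using lipschitz_onD[OF lip xy] by (simp add: dist_norm)
    finally show "dist (f x \<bullet> b) (f y \<bullet> b) \<le> L * dist x y" .
  qed
  then have "\<forall>b\<in>Basis. \<exists>g. L-lipschitz_on UNIV g \<and> (\<forall>x\<in>A. g x = f x \<bullet> b)"
    by (blast intro: lipschitz_extension_real[OF _ False])
  then obtain g where g: "\<And>b. b \<in> Basis \<Longrightarrow> L-lipschitz_on UNIV (g b)"
    "\<And>b x. b \<in> Basis \<Longrightarrow> x \<in> A \<Longrightarrow> g b x = f x \<bullet> b" by metis
  define h where "h x = (\<Sum>b\<in>Basis. g b x *\<^sub>R b)" for x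
  show ?thesis
  proof
    show "(real DIM('b) * L)-lipschitz_on UNIV h"
    proof (rule lipschitz_onI)
      fix x y
      have "dist (h x) (h y) = norm (\<Sum>b\<in>Basis. (g b x - g b y) *\<^sub>R b)"
        by (simp add: h_def dist_norm scaleR_diff_left sum_subtractf)
      also have "\<dots> \<le> (\<Sum>b\<in>(Basis :: 'b set). L * dist x y)"
        using lipschitz_onD[OF g(1)] by (intro sum_norm_le) (auto simp: dist_real_def)
      finally show "dist (h x) (h y) \<le> real DIM('b) * L * dist x y" by simp
    qed (use lipschitz_on_nonneg[OF lip] in auto)
    show "h x = f x" if "x \<in> A" for x
      using that by (simp add: h_def g(2) euclidean_representation)
  qed
qed

text \<open>
  If no difference of two points of \<open>E\<close> lies in the bad cone, then \<open>proj V x\<close> determines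
  \<open>x - proj V x\<close> for \<open>x \<in> E\<close>, and does so in an \<open>\<alpha>\<close>-Lipschitz way. The extension to all of \<open>V\<close> may leave
  the orthogonal complement and is projected back onto it, which does not increase the constant.
\<close>

lemma subset_lipschitz_graph:
  fixes E :: "'a::euclidean_space set"
  assumes V: "V \<in> grassmannian m" and "\<alpha> \<ge> 0"
    and avoid: "\<And>x y. x \<in> E \<Longrightarrow> y \<in> E \<Longrightarrow> y - x \<notin> bad_cone V \<alpha>"
  obtains G where "G \<in> lipschitz_graphs m" "E \<subseteq> G"
proof -
  note sub = grassmannian_subspace[OF V]
  have le: "norm ((x - proj V x) - (y - proj V y)) \<le> \<alpha> * norm (proj V x - proj V y)"
    if "x \<in> E" "y \<in> E" for x y
    using avoid[OF that(2,1)] by (simp add: mem_bad_cone_iff[OF sub] proj_diff[OF sub] algebra_simps)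
  have inj: "inj_on (proj V) E"
  proof
    fix x y assume "x \<in> E" "y \<in> E" "proj V x = proj V y"
    with le[of x y] show "x = y" by simp
  qed
  define f where "f z = (let x = the_inv_into E (proj V) z in x - proj V x)" for z
  have f: "f (proj V x) = x - proj V x" if "x \<in> E" for x
    using that by (simp add: f_def the_inv_into_f_f[OF inj])
  have "\<alpha>-lipschitz_on (proj V ` E) f"
    using le assms(2) by (intro lipschitz_onI) (auto simp: f dist_norm)
  then obtain g where g: "(real DIM('a) * \<alpha>)-lipschitz_on UNIV g" "\<And>z. z \<in> proj V ` E \<Longrightarrow> g z = f z"
    using lipschitz_extension by blast
  define h where "h z = g z - proj V (g z)" for z
  have h: "(real DIM('a) * \<alpha>)-lipschitz_on V h"
  proof (rule lipschitz_onI)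
    fix x y
    have "dist (h x) (h y) = norm ((g x - g y) - proj V (g x - g y))"
      by (simp add: h_def dist_norm proj_diff[OF sub] algebra_simps)
    also have "\<dots> \<le> dist (g x) (g y)" by (simp add: dist_norm norm_diff_proj_le[OF sub])
    also have "\<dots> \<le> real DIM('a) * \<alpha> * dist x y" using g(1) by (rule lipschitz_onD) auto
    finally show "dist (h x) (h y) \<le> real DIM('a) * \<alpha> * dist x y" .
  qed (use assms in auto)
  have "h ` V \<subseteq> V\<^sup>\<bottom>" using sub by (auto simp: h_def)
  then have "{x + h x | x. x \<in> V} \<in> lipschitz_graphs m"
    using V h unfolding lipschitz_graphs_def by blast
  moreover have "E \<subseteq> {x + h x | x. x \<in> V}"
  proof
    fix x assume x: "x \<in> E"
    have "h (proj V x) = x - proj V x"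
      using x g(2) f sub by (simp add: h_def proj_of_comp)
    then show "x \<in> {x + h x | x. x \<in> V}"
      using proj_in[OF sub, of x] by (intro CollectI exI[of _ "proj V x"]) simp
  qed
  ultimately show ?thesis using that by blast
qed

section \<open>Dyadic cubes of side at most 1\<close>

text \<open>
  Only cubes of side at most 1 matter, and these have side \<open>1 / 2 ^ k\<close> with a natural number \<open>k\<close>. For
  each \<open>k\<close> exactly one of them contains a given point; \<open>cube_index k x\<close> is its index.
\<close>

definition cube_index :: "nat \<Rightarrow> real ^ 'n \<Rightarrow> int ^ 'n" where
  "cube_index k x = (\<chi> i. \<lfloor>x $ i * 2 ^ k\<rfloor>)"

definition grid_cube :: "nat \<Rightarrow> int ^ 'n \<Rightarrow> (real ^ 'n) set" where
  "grid_cube k j = dyadic_cube (int k) j"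

lemma powi_minus_nat: "(2::real) powi (- int k) = 1 / 2 ^ k"
  by (simp add: power_int_minus divide_inverse)

lemma mem_grid_cube_iff: "x \<in> grid_cube k j \<longleftrightarrow> cube_index k x = j"
proof -
  have "real_of_int (j $ i) * 2 powi (- int k) \<le> x $ i \<and> x $ i < (real_of_int (j $ i) + 1) * 2 powi (- int k)
     \<longleftrightarrow> \<lfloor>x $ i * 2 ^ k\<rfloor> = j $ i" for i
    unfolding powi_minus_nat by (simp add: floor_eq_iff field_simps)
  then show ?thesis
    by (auto simp: grid_cube_def dyadic_cube_def cube_index_def vec_eq_iff)
qed

lemma cube_index_refine:
  fixes x y :: "real ^ 'n"
  assumes "cube_index (Suc k) x = cube_index (Suc k) y" shows "cube_index k x = cube_index k y"
proof -
  have "cube_index k z $ i = cube_index (Suc k) z $ i div 2" for z :: "real ^ 'n" and i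
    using floor_divide_real_eq_div[of 2 "z $ i * 2 ^ Suc k"] by (simp add: cube_index_def)
  with assms show ?thesis by (simp add: vec_eq_iff)
qed

lemma norm_le_sqrt_card:
  fixes x :: "real ^ 'n"
  assumes "\<And>i. \<bar>x $ i\<bar> \<le> B"
  shows "norm x \<le> sqrt (real CARD('n)) * B"
proof -
  have B: "B \<ge> 0" using assms[of undefined] by linarith
  have "norm x = sqrt (\<Sum>i\<in>UNIV. (x $ i)\<^sup>2)"
    by (simp add: norm_vec_def L2_set_def)
  also have "\<dots> \<le> sqrt (\<Sum>i\<in>(UNIV::'n set). B\<^sup>2)"
    using assms B by (intro real_sqrt_le_mono sum_mono) (simp add: abs_le_square_iff[symmetric])
  also have "\<dots> = sqrt (real CARD('n)) * B"
    using B by (simp add: real_sqrt_mult)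
  finally show ?thesis .
qed

lemma grid_cube_diam:
  fixes x y :: "real ^ 'n"
  assumes "x \<in> grid_cube k j" "y \<in> grid_cube k j"
  shows "norm (x - y) \<le> sqrt (real CARD('n)) / 2 ^ k"
proof -
  have "\<bar>(x - y) $ i\<bar> \<le> 1 / 2 ^ k" for i
  proof -
    have "\<lfloor>x $ i * 2 ^ k\<rfloor> = \<lfloor>y $ i * 2 ^ k\<rfloor>"
      using assms unfolding mem_grid_cube_iff cube_index_def by (metis vec_lambda_beta)
    then have "\<bar>x $ i * 2 ^ k - y $ i * 2 ^ k\<bar> \<le> 1" by linarith
    then have "\<bar>(x - y) $ i\<bar> * 2 ^ k \<le> 1"
      by (simp add: left_diff_distrib[symmetric] abs_mult)
    then show ?thesis by (simp add: field_simps)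
  qed
  from norm_le_sqrt_card[of "x - y", OF this] show ?thesis by simp
qed

lemma center_in_grid_cube: "center (grid_cube k j) \<in> grid_cube k j"
proof -
  have "(real_of_int (j $ i) + 1 / 2) * 2 ^ k / 2 ^ k = real_of_int (j $ i) + 1 / 2" for i
    by simp
  then have "\<lfloor>(real_of_int (j $ i) + 1 / 2) / 2 ^ k * 2 ^ k\<rfloor> = j $ i" for i
    by (simp add: floor_eq_iff)
  moreover have "center (grid_cube k j) = (\<chi> i. (of_int (j $ i) + 1 / 2) * 2 powi (- int k))"
    by (simp only: grid_cube_def center_dyadic_cube)
  ultimately show ?thesis
    by (simp add: mem_grid_cube_iff cube_index_def vec_eq_iff powi_minus_nat
        del: times_divide_eq_left)
qed

lemma side_grid_cube: "side (grid_cube k j) = 1 / 2 ^ k"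
  by (simp only: grid_cube_def side_dyadic_cube powi_minus_nat)

lemma grid_cube_borel [measurable, simp]: "grid_cube k (j :: int ^ 'n) \<in> sets borel"
proof -
  have "grid_cube k j = (\<Inter>i. {x. real_of_int (j $ i) * 2 powi (- int k) \<le> x $ i} \<inter>
      {x. x $ i < (real_of_int (j $ i) + 1) * 2 powi (- int k)})"
    by (auto simp: grid_cube_def dyadic_cube_def)
  also have "\<dots> \<in> sets borel"
    by (intro sets.finite_INT sets.Int borel_closed borel_open closed_Collect_le open_Collect_less continuous_intros) auto
  finally show ?thesis .
qed

lemma bounded_grid_cube: "bounded (grid_cube k j)"
  using grid_cube_diam[OF center_in_grid_cube[of k j]]
  by (auto simp: bounded_def dist_norm)

lemma dyadic_cubes_side_le_1: "{Q \<in> dyadic_cubes. side Q \<le> 1} = {grid_cube k j | k j. True}"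
proof (intro equalityI subsetI)
  fix Q :: "(real ^ 'n) set" assume "Q \<in> {Q \<in> dyadic_cubes. side Q \<le> 1}"
  then obtain k j where Q: "Q = dyadic_cube k j" "(2::real) powi (- k) \<le> 1"
    by (auto simp: dyadic_cubes_def side_dyadic_cube)
  have "k \<ge> 0"
  proof (rule ccontr)
    assume "\<not> k \<ge> 0"
    then have "(2::real) powi 0 < 2 powi (- k)"
      by (intro power_int_strict_increasing) auto
    with Q(2) show False by simp
  qed
  then show "Q \<in> {grid_cube k j | k j. True}"
    using Q(1) by (auto simp: grid_cube_def elim!: nonneg_int_cases)
qed (auto simp: dyadic_cubes_def side_grid_cube, auto simp: grid_cube_def)

lemma dyadic_cubes_side_eq:
  "{R \<in> dyadic_cubes. side R = side (grid_cube k j)} = range (grid_cube k)"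
proof (intro equalityI subsetI)
  fix R :: "(real ^ 'n) set" assume "R \<in> {R \<in> dyadic_cubes. side R = side (grid_cube k j)}"
  then obtain l i where R: "R = dyadic_cube l i" "(2::real) powi (- l) = 2 powi (- int k)"
    by (auto simp: dyadic_cubes_def side_dyadic_cube grid_cube_def)
  have "l = int k"
    using power_int_strict_increasing[of "- l" "- int k" "2::real"]
      power_int_strict_increasing[of "- int k" "- l" "2::real"] R(2) by linarith
  with R(1) show "R \<in> range (grid_cube k)" by (auto simp: grid_cube_def)
qed (auto simp: dyadic_cubes_def side_dyadic_cube grid_cube_def)

lemma infsum_UNIV_nat_ennreal: "infsum f (UNIV :: nat set) = (\<Sum>k. f k :: ennreal)"
proof -
  have "f summable_on UNIV" by (rule nonneg_summable_on_complete) auto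
  then have "(f has_sum infsum f UNIV) UNIV" by (rule has_sum_infsum)
  then show ?thesis by (metis has_sum_imp_sums sums_unique)
qed

text \<open>
  The cubes of side at most 1 that contain \<open>x\<close> are one for each generation \<open>k\<close>.
\<close>

lemma conical_dini_eq_suminf:
  "conical_dini \<mu> V \<alpha> x = (\<Sum>k. conical_defect \<mu> (grid_cube k (cube_index k x)) V \<alpha>)"
proof -
  let ?Q = "\<lambda>k. grid_cube k (cube_index k x)"
  have inj: "inj ?Q"
    by (auto simp: inj_on_def grid_cube_def dyadic_cube_eq_iff)
  have "conical_dini \<mu> V \<alpha> x = (\<Sum>\<^sub>\<infinity>Q\<in>range ?Q. conical_defect \<mu> Q V \<alpha>)"
    unfolding conical_dini_def dyadic_cubes_side_le_1
  proof (rule infsum_cong_neutral)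
    fix Q assume "Q \<in> {grid_cube k j | k j. True} - range ?Q"
    then obtain k j where "Q = grid_cube k j" "Q \<noteq> ?Q k" by blast
    then have "x \<notin> Q" by (auto simp: mem_grid_cube_iff)
    then show "conical_defect \<mu> Q V \<alpha> * indicator Q x = 0" by simp
  next
    fix Q assume "Q \<in> {grid_cube k j | k j. True} \<inter> range ?Q"
    then obtain k where "Q = ?Q k" by blast
    then have "x \<in> Q" by (simp add: mem_grid_cube_iff)
    then show "conical_defect \<mu> Q V \<alpha> * indicator Q x = conical_defect \<mu> Q V \<alpha>" by simp
  qed auto
  also have "\<dots> = (\<Sum>\<^sub>\<infinity>k. conical_defect \<mu> (?Q k) V \<alpha>)"
    by (subst infsum_reindex[OF inj]) (simp add: o_def)
  finally show ?thesis by (simp add: infsum_UNIV_nat_ennreal)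
qed

lemma finite_index_box: "finite {j :: int ^ 'n. \<forall>i. \<bar>j $ i\<bar> \<le> B}"
proof -
  have "{j :: int ^ 'n. \<forall>i. \<bar>j $ i\<bar> \<le> B} \<subseteq> vec_lambda ` (PiE UNIV (\<lambda>_. {-B..B}))"
  proof
    fix j :: "int ^ 'n" assume "j \<in> {j. \<forall>i. \<bar>j $ i\<bar> \<le> B}"
    then have "vec_nth j \<in> PiE UNIV (\<lambda>_. {-B..B})" by (auto simp: abs_le_iff minus_le_iff)
    then show "j \<in> vec_lambda ` (PiE UNIV (\<lambda>_. {-B..B}))"
      by (metis image_eqI vec_nth_inverse)
  qed
  then show ?thesis
    by (rule finite_subset) (intro finite_imageI finite_PiE, auto)
qed

text \<open>
  The number of indices within distance \<open>B\<close> of \<open>a\<close> does not depend on \<open>a\<close>, so one constant bounds the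
  overlap of annular regions at all points.
\<close>

lemma finite_index_box_around: "finite {j :: int ^ 'n. \<forall>i. \<bar>j $ i - a $ i\<bar> \<le> B}"
  and card_index_box_around: "card {j :: int ^ 'n. \<forall>i. \<bar>j $ i - a $ i\<bar> \<le> B} = card {j :: int ^ 'n. \<forall>i. \<bar>j $ i\<bar> \<le> B}"
proof -
  have "{j :: int ^ 'n. \<forall>i. \<bar>j $ i - a $ i\<bar> \<le> B} = (\<lambda>j. j + a) ` {j. \<forall>i. \<bar>j $ i\<bar> \<le> B}"
  proof (intro equalityI subsetI)
    fix j :: "int ^ 'n" assume "j \<in> {j. \<forall>i. \<bar>j $ i - a $ i\<bar> \<le> B}"
    then show "j \<in> (\<lambda>j. j + a) ` {j. \<forall>i. \<bar>j $ i\<bar> \<le> B}"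
      by (intro image_eqI[of _ _ "j - a"]) auto
  qed auto
  then show "finite {j :: int ^ 'n. \<forall>i. \<bar>j $ i - a $ i\<bar> \<le> B}"
    "card {j :: int ^ 'n. \<forall>i. \<bar>j $ i - a $ i\<bar> \<le> B} = card {j :: int ^ 'n. \<forall>i. \<bar>j $ i\<bar> \<le> B}"
    by (simp_all add: finite_index_box card_image)
qed

lemma cube_index_diff_le:
  assumes "norm (x - y) \<le> C / 2 ^ k"
  shows "\<bar>cube_index k x $ i - cube_index k y $ i\<bar> \<le> \<lceil>C\<rceil> + 1"
proof -
  have "\<bar>(x - y) $ i\<bar> \<le> C / 2 ^ k"
    using component_le_norm_cart[of "x - y" i] assms by linarith
  moreover have "\<bar>x $ i * 2 ^ k - y $ i * 2 ^ k\<bar> = \<bar>(x - y) $ i\<bar> * 2 ^ k"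
    by (simp add: left_diff_distrib[symmetric] abs_mult)
  ultimately have "\<bar>x $ i * 2 ^ k - y $ i * 2 ^ k\<bar> \<le> C"
    by (simp add: pos_le_divide_eq)
  then show ?thesis
    unfolding cube_index_def vec_lambda_beta by linarith
qed

lemma defect_cubes_grid_cube:
  "defect_cubes (grid_cube k j) V \<alpha> = grid_cube k ` {i. grid_cube k i \<inter> conical_annulus (grid_cube k j) V \<alpha> \<noteq> {}}"
  using dyadic_cubes_side_eq[of k j] unfolding defect_cubes_def by auto

lemma finite_defect_cubes:
  fixes V :: "(real ^ 'n) set"
  shows "finite (defect_cubes (grid_cube k j) V \<alpha>)"
proof -
  let ?c = "center (grid_cube k j)" and ?r = "defect_radius (grid_cube k j) \<alpha>"
  have "{i. grid_cube k i \<inter> conical_annulus (grid_cube k j) V \<alpha> \<noteq> {}} \<subseteq>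
    {i. \<forall>l. \<bar>i $ l - cube_index k ?c $ l\<bar> \<le> \<lceil>?r * 2 ^ k\<rceil> + 1}"
  proof
    fix i assume "i \<in> {i. grid_cube k i \<inter> conical_annulus (grid_cube k j) V \<alpha> \<noteq> {}}"
    then obtain z where z: "z \<in> grid_cube k i" "z \<in> cball ?c ?r"
      by (auto simp: conical_annulus_def)
    then have "norm (z - ?c) \<le> ?r * 2 ^ k / 2 ^ k" by (simp add: dist_norm norm_minus_commute)
    from cube_index_diff_le[OF this] show "i \<in> {i. \<forall>l. \<bar>i $ l - cube_index k ?c $ l\<bar> \<le> \<lceil>?r * 2 ^ k\<rceil> + 1}"
      using z(1) by (auto simp: mem_grid_cube_iff)
  qed
  from finite_subset[OF this finite_index_box_around] show ?thesis
    unfolding defect_cubes_grid_cube by (rule finite_imageI)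
qed

text \<open>
  The cubes that enter the defect are finitely many and disjoint, so the sum of their measures is the
  measure of their union.
\<close>

lemma conical_defect_grid_cube:
  assumes sets: "sets M = sets borel" and em: "\<And>A. A \<in> sets borel \<Longrightarrow> emeasure M A = \<mu> A"
  shows "conical_defect \<mu> (grid_cube k j) V \<alpha> =
    (if emeasure M (grid_cube k j) > 0
     then emeasure M (\<Union>(defect_cubes (grid_cube k j) V \<alpha>)) / emeasure M (grid_cube k j) else 0)"
proof -
  let ?D = "defect_cubes (grid_cube k j) V \<alpha>"
  have mu: "\<mu> (grid_cube k i) = emeasure M (grid_cube k i)" for i
    by (simp add: em)
  have sub: "?D \<subseteq> range (grid_cube k)"
    unfolding defect_cubes_grid_cube by auto
  have "(\<Sum>\<^sub>\<infinity>R\<in>?D. \<mu> R / \<mu> (grid_cube k j)) = (\<Sum>R\<in>?D. emeasure M R / emeasure M (grid_cube k j))"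
    using sub mu by (subst infsum_finite) (auto simp: finite_defect_cubes intro!: sum.cong)
  also have "\<dots> = (\<Sum>R\<in>?D. emeasure M R) / emeasure M (grid_cube k j)"
    by (simp add: divide_ennreal_def sum_distrib_right)
  also have "(\<Sum>R\<in>?D. emeasure M R) = emeasure M (\<Union>R\<in>?D. R)"
  proof (rule sum_emeasure)
    show "disjoint_family_on (\<lambda>R. R) ?D"
      unfolding disjoint_family_on_def
    proof (intro ballI impI)
      fix R R' assume "R \<in> ?D" "R' \<in> ?D" "R \<noteq> R'"
      moreover obtain i where "R = grid_cube k i" using \<open>R \<in> ?D\<close> sub by auto
      moreover obtain i' where "R' = grid_cube k i'" using \<open>R' \<in> ?D\<close> sub by auto
      ultimately show "R \<inter> R' = {}" by (auto simp: disjoint_iff mem_grid_cube_iff)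
    qed
    show "(\<lambda>R. R) ` ?D \<subseteq> sets M"
      using sub sets by auto
  qed (rule finite_defect_cubes)
  finally show ?thesis
    by (simp add: conical_defect_def mu)
qed

lemma Union_defect_cubes_borel [measurable, simp]:
  "\<Union>(defect_cubes (grid_cube k j) V \<alpha>) \<in> sets borel"
proof (rule sets.finite_Union[OF finite_defect_cubes])
  show "defect_cubes (grid_cube k j) V \<alpha> \<subseteq> sets borel"
    unfolding defect_cubes_grid_cube by auto
qed

text \<open>
  Partitions are indexed by natural numbers, so that all sums over cells are ordinary series.
\<close>

abbreviation cube_code :: "nat \<Rightarrow> real ^ 'n \<Rightarrow> nat" where
  "cube_code k x \<equiv> to_nat (cube_index k x)"

lemma cube_code_measurable:
  fixes M :: "(real ^ 'n) measure"
  assumes "sets M = sets borel"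
  shows "cube_code k \<in> measurable M (count_space UNIV)"
proof -
  have "cube_code k -` {n} \<inter> space M \<in> sets M" for n
  proof (cases "n \<in> range (to_nat :: int ^ 'n \<Rightarrow> nat)")
    case True
    then obtain j :: "int ^ 'n" where "n = to_nat j" by auto
    then have "cube_code k -` {n} \<inter> space M = grid_cube k j"
      using sets_eq_imp_space_eq[OF assms] by (auto simp: mem_grid_cube_iff)
    then show ?thesis using assms by simp
  next
    case False
    then have "cube_code k -` {n} = ({} :: (real ^ 'n) set)"
    proof -
      have "to_nat (cube_index k x) \<noteq> n" for x :: "real ^ 'n" using False by (metis rangeI)
      then show ?thesis by auto
    qed
    then show ?thesis by simp
  qed
  then show ?thesis by (simp add: measurable_count_space_eq2_countable)
qed

section \<open>Covering by Lipschitz graphs\<close>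

text \<open>
  Subspaces are identified with the matrices of their projections; any set of matrices is separable.
\<close>

lemma countable_dense_grassmannian:
  obtains \<V> :: "(real ^ 'n) set set" where "countable \<V>" "\<V> \<subseteq> grassmannian m"
    "\<forall>V\<in>grassmannian m. \<forall>\<epsilon>>0. \<exists>W\<in>\<V>. \<forall>x. norm (proj V x - proj W x) \<le> \<epsilon> * norm x"
proof -
  define p :: "(real ^ 'n) set \<Rightarrow> real ^ 'n ^ 'n" where "p V = matrix (proj V)" for V
  obtain T where T: "countable T" "T \<subseteq> p ` grassmannian m" "p ` grassmannian m \<subseteq> closure T"
    using separable by blast
  from T(2) obtain \<V> where \<V>: "\<V> \<subseteq> grassmannian m" "inj_on p \<V>" "T = p ` \<V>"
    by (meson subset_image_inj)
  have approx: "\<exists>W\<in>\<V>. \<forall>x. norm (proj V x - proj W x) \<le> \<epsilon> * norm x"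
    if V: "V \<in> grassmannian m" and \<epsilon>: "\<epsilon> > 0" for V \<epsilon>
  proof -
    \<comment> \<open>The operator norm is at most the dimension squared times the largest entry.\<close>
    define \<delta> where "\<delta> = \<epsilon> / (real CARD('n) * real CARD('n))"
    have "\<delta> > 0" using \<epsilon> by (simp add: \<delta>_def)
    moreover have "p V \<in> closure (p ` \<V>)" using T(3) V \<V>(3) by blast
    ultimately obtain W where W: "W \<in> \<V>" "dist (p W) (p V) < \<delta>"
      unfolding closure_approachable by blast
    have "norm (proj V x - proj W x) \<le> \<epsilon> * norm x" for x
    proof -
      have entry: "\<bar>(p V - p W) $ i $ j\<bar> \<le> \<delta>" for i j
      proof -
        have "\<bar>(p V - p W) $ i $ j\<bar> = dist (p V $ i $ j) (p W $ i $ j)" by (simp add: dist_real_def)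
        also have "\<dots> \<le> dist (p V $ i) (p W $ i)" by (rule dist_vec_nth_le)
        also have "\<dots> \<le> dist (p V) (p W)" by (rule dist_vec_nth_le)
        finally show ?thesis using W(2) by (simp add: dist_commute)
      qed
      have p: "proj U x = p U *v x" if "U \<in> grassmannian m" for U
        unfolding p_def by (simp add: matrix_works linear_matrix_vector_mul_eq linear_proj[OF grassmannian_subspace[OF that]])
      have "proj V x - proj W x = (p V - p W) *v x"
        using V W(1) \<V>(1) by (simp add: p subset_iff matrix_vector_mult_diff_rdistrib)
      also have "norm \<dots> \<le> onorm ((*v) (p V - p W)) * norm x"
        by (rule onorm) (rule matrix_vector_mul_bounded_linear)
      also have "\<dots> \<le> (real CARD('n) * real CARD('n) * \<delta>) * norm x"
        by (intro mult_right_mono onorm_le_matrix_component entry) auto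
      finally show ?thesis by (simp add: \<delta>_def)
    qed
    then show ?thesis using W(1) by blast
  qed
  have "countable \<V>"
    using T(1) \<V>(2,3) by (simp add: countable_image_inj_eq)
  then show ?thesis
    by (rule that[OF _ \<V>(1)]) (intro ballI allI impI approx)
qed

text \<open>
  A vector \<open>x\<close> in the narrower cone \<open>X(W, b)\<close> has \<open>norm x \<le> 2 * norm (x - proj W x)\<close>, because \<open>b \<ge> 1\<close>.
  Hence replacing \<open>proj W\<close> by \<open>proj V\<close> changes either component by at most
  \<open>norm (x - proj W x) / (2 * (1 + \<alpha>))\<close>, and the slack between \<open>b\<close> and \<open>2 * \<alpha>\<close> absorbs this.
\<close>

lemma bad_cone_subset_of_close:
  assumes V: "subspace V" and W: "subspace W" and "\<alpha> > 0" and b: "b \<ge> 1" "b \<ge> 2 * \<alpha>"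
    and close: "\<And>x. norm (proj V x - proj W x) \<le> 1 / (4 * (1 + \<alpha>)) * norm x"
  shows "bad_cone W b \<subseteq> bad_cone V \<alpha>"
proof
  fix x assume "x \<in> bad_cone W b"
  then have x: "b * norm (proj W x) < norm (x - proj W x)" (is "_ < ?t")
    by (simp add: mem_bad_cone_iff[OF W])
  have t: "?t > 0" using x b(1) by (smt (verit) mult_nonneg_nonneg norm_ge_zero)
  have "norm (proj W x) \<le> b * norm (proj W x)"
    using mult_right_mono[OF b(1), of "norm (proj W x)"] by simp
  then have "norm x \<le> 2 * ?t"
    using norm_le_proj[OF W, of x] x by linarith
  then have "1 / (4 * (1 + \<alpha>)) * norm x \<le> 1 / (4 * (1 + \<alpha>)) * (2 * ?t)"
    using \<open>\<alpha> > 0\<close> by (intro mult_left_mono) auto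
  also have "\<dots> = ?t / (2 * (1 + \<alpha>))" using \<open>\<alpha> > 0\<close> by (simp add: field_simps)
  finally have d: "norm (proj V x - proj W x) \<le> ?t / (2 * (1 + \<alpha>))" using close[of x] by linarith
  have "norm (proj V x) \<le> norm (proj W x) + norm (proj V x - proj W x)"
    using norm_triangle_ineq[of "proj W x" "proj V x - proj W x"] by simp
  then have "\<alpha> * norm (proj V x) \<le> \<alpha> * (norm (proj W x) + ?t / (2 * (1 + \<alpha>)))"
    using d \<open>\<alpha> > 0\<close> by (intro mult_left_mono) auto
  moreover have "2 * \<alpha> * norm (proj W x) < ?t"
    using x mult_right_mono[OF b(2), of "norm (proj W x)"] by simp
  moreover have "?t \<le> norm (x - proj V x) + norm (proj V x - proj W x)"
    using norm_triangle_ineq[of "x - proj V x" "proj V x - proj W x"] by simp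
  moreover have scaled: "c * (2 * (1 + \<alpha>)) = t \<Longrightarrow> \<alpha> * c + c = t / 2" for c t :: real
    by (simp add: algebra_simps)
  have "?t / (2 * (1 + \<alpha>)) * (2 * (1 + \<alpha>)) = ?t"
    using \<open>\<alpha> > 0\<close> by simp
  then have "\<alpha> * (?t / (2 * (1 + \<alpha>))) + ?t / (2 * (1 + \<alpha>)) = ?t / 2"
    by (rule scaled)
  ultimately have "\<alpha> * norm (proj V x) < norm (x - proj V x)"
    using d by (simp add: distrib_left)
  then show "x \<in> bad_cone V \<alpha>" by (simp add: mem_bad_cone_iff[OF V])
qed

text \<open>
  A conical annulus whose opening \<open>b\<close> and radius parameter \<open>\<beta>\<close> are decoupled, and whose radii have ratio
  5/2 instead of 3. The smaller ratio leaves room to move the radius by a factor 5/6 to a rational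
  parameter without leaving the annulus of \<open>X(V, \<alpha>)\<close>. It is still larger than 2, the ratio of the sides of
  consecutive cubes, so the thin annuli of the cubes around a point cover a punctured ball of the cone.
\<close>

definition thin_annulus :: "nat \<Rightarrow> int ^ 'n \<Rightarrow> (real ^ 'n) set \<Rightarrow> real \<Rightarrow> real \<Rightarrow> (real ^ 'n) set" where
  "thin_annulus k j V b \<beta> = translates (bad_cone V b) (grid_cube k j)
     \<inter> cball (center (grid_cube k j)) (81 * sqrt (real CARD('n)) * \<beta> / 2 ^ k)
     - ball (center (grid_cube k j)) (2 / 5 * (81 * sqrt (real CARD('n)) * \<beta> / 2 ^ k))"

lemma thin_annulus_borel:
  assumes "subspace V" shows "thin_annulus k j V b \<beta> \<in> sets borel"
proof -
  have "open (translates (bad_cone V b) (grid_cube k j))"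
    unfolding translates_def by (intro open_UN ballI open_translation open_bad_cone assms)
  then show ?thesis unfolding thin_annulus_def by auto
qed

lemma thin_annulus_subset:
  fixes V :: "(real ^ 'n) set"
  assumes "bad_cone W b \<subseteq> bad_cone V \<alpha>" and "\<beta> \<le> max \<alpha> (1 / \<alpha>)" "5 / 6 * max \<alpha> (1 / \<alpha>) \<le> \<beta>"
  shows "thin_annulus k j W b \<beta> \<subseteq> conical_annulus (grid_cube k j) V \<alpha>"
proof -
  define q where "q = 81 * sqrt (real CARD('n)) / 2 ^ k"
  have q: "q \<ge> 0" by (simp add: q_def)
  have r: "defect_radius (grid_cube k j) \<alpha> = q * max \<alpha> (1 / \<alpha>)"
    by (simp add: defect_radius_def side_grid_cube q_def)
  have r': "81 * sqrt (real CARD('n)) * \<beta> / 2 ^ k = q * \<beta>"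
    by (simp add: q_def)
  have outer: "q * \<beta> \<le> defect_radius (grid_cube k j) \<alpha>"
    unfolding r using assms(2) q by (rule mult_left_mono)
  have "q * (5 / 6 * max \<alpha> (1 / \<alpha>)) \<le> q * \<beta>"
    using assms(3) q by (rule mult_left_mono)
  moreover have "q * (5 / 6 * max \<alpha> (1 / \<alpha>)) = 5 / 6 * (q * max \<alpha> (1 / \<alpha>))"
    by (rule mult.left_commute)
  moreover have weaken: "5 / 6 * a \<le> b \<Longrightarrow> a / 3 \<le> 2 / 5 * b" for a b :: real
    by linarith
  ultimately have inner: "defect_radius (grid_cube k j) \<alpha> / 3 \<le> 2 / 5 * (q * \<beta>)"
    unfolding r using weaken by simp
  have "translates (bad_cone W b) (grid_cube k j) \<subseteq> translates (bad_cone V \<alpha>) (grid_cube k j)"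
    using assms(1) unfolding translates_def by blast
  moreover have "cball (center (grid_cube k j)) (q * \<beta>) \<subseteq> cball (center (grid_cube k j)) (defect_radius (grid_cube k j) \<alpha>)"
    using outer by (rule subset_cball)
  moreover have "ball (center (grid_cube k j)) (defect_radius (grid_cube k j) \<alpha> / 3) \<subseteq> ball (center (grid_cube k j)) (2 / 5 * (q * \<beta>))"
    using inner by (rule subset_ball)
  ultimately show ?thesis
    unfolding thin_annulus_def conical_annulus_def r' by blast
qed

lemma conical_annulus_subset_defect_cubes:
  "conical_annulus (grid_cube k j) V \<alpha> \<subseteq> \<Union>(defect_cubes (grid_cube k j) V \<alpha>)"
proof
  fix y assume y: "y \<in> conical_annulus (grid_cube k j) V \<alpha>"
  have "y \<in> grid_cube k (cube_index k y)" by (simp add: mem_grid_cube_iff)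
  with y show "y \<in> \<Union>(defect_cubes (grid_cube k j) V \<alpha>)"
    unfolding defect_cubes_grid_cube by blast
qed

text \<open>
  The largest \<open>k\<close> with \<open>d \<le> a / 2 ^ k\<close>.
\<close>

lemma exists_scale:
  fixes a d :: real
  assumes "0 < d" "d \<le> a / 2 ^ k0"
  obtains k where "k \<ge> k0" "d \<le> a / 2 ^ k" "a / 2 ^ k < 2 * d"
proof -
  have a: "a > 0" using assms by (smt (verit) divide_nonpos_pos zero_less_power)
  obtain n :: nat where "a / d < 2 ^ n"
    using real_arch_pow[of 2 "a / d"] by auto
  then have "a / 2 ^ n < d" using assms(1) by (simp add: field_simps)
  then have ex: "\<exists>n. a / 2 ^ n < d" by blast
  define n0 where "n0 = (LEAST n. a / 2 ^ n < d)"
  have n0: "a / 2 ^ n0 < d" unfolding n0_def using ex by (rule LeastI_ex)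
  have "k0 < n0"
  proof (rule ccontr)
    assume "\<not> k0 < n0"
    then have "a / 2 ^ k0 \<le> a / 2 ^ n0"
      using a by (intro divide_left_mono power_increasing) auto
    with n0 assms show False by simp
  qed
  then obtain k where k: "n0 = Suc k" by (cases n0) auto
  have "\<not> a / 2 ^ k < d" using not_less_Least[of k "\<lambda>n. a / 2 ^ n < d"] k by (simp add: n0_def)
  moreover have "a / 2 ^ k < 2 * d" using n0 k by simp
  ultimately show ?thesis using that[of k] \<open>k0 < n0\<close> k by auto
qed

text \<open>
  If \<open>y - x\<close> were in the cone, then \<open>y\<close> would be in the thin annulus of the cube around \<open>x\<close> at the scale
  comparable to \<open>norm (y - x)\<close>. The center of that cube differs from \<open>x\<close> by at most \<open>u = sqrt n / 2 ^ k\<close>, so the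
  scale is chosen such that \<open>norm (y - x)\<close> is between \<open>(81 * \<beta> - 1) * u / 2\<close> and \<open>(81 * \<beta> - 1) * u\<close>.
\<close>

lemma diff_notin_bad_cone:
  fixes x y :: "real ^ 'n"
  assumes \<beta>: "\<beta> \<ge> 5 / 6"
    and avoid: "\<And>k. k \<ge> k0 \<Longrightarrow> y \<notin> thin_annulus k (cube_index k x) V b \<beta>"
    and near: "norm (y - x) \<le> sqrt (real CARD('n)) / 2 ^ k0"
    and "subspace V"
  shows "y - x \<notin> bad_cone V b"
proof
  assume bad: "y - x \<in> bad_cone V b"
  have "proj V 0 = 0" using \<open>subspace V\<close> by (intro proj_of_mem) (auto simp: subspace_0)
  then have "y - x \<noteq> 0"
    using bad mem_bad_cone_iff[OF \<open>subspace V\<close>, of 0] by auto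
  let ?n = "sqrt (real CARD('n))"
  define d where "d = norm (y - x)"
  have d: "d > 0" using \<open>y - x \<noteq> 0\<close> by (simp add: d_def)
  have "?n / 2 ^ k0 * 1 \<le> ?n / 2 ^ k0 * (81 * \<beta> - 1)"
    using \<beta> by (intro mult_left_mono) auto
  then have "d \<le> ((81 * \<beta> - 1) * ?n) / 2 ^ k0" using near by (simp add: d_def mult.commute)
  from exists_scale[OF d this] obtain k where k: "k \<ge> k0"
    "d \<le> (81 * \<beta> - 1) * ?n / 2 ^ k" "(81 * \<beta> - 1) * ?n / 2 ^ k < 2 * d" by blast
  define u where "u = ?n / 2 ^ k"
  have u: "u > 0" by (simp add: u_def)
  have k': "d \<le> 81 * (\<beta> * u) - u" "81 * (\<beta> * u) - u < 2 * d"
    using k(2,3) by (simp_all add: u_def algebra_simps diff_divide_distrib)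
  have bu: "5 / 6 * u \<le> \<beta> * u" using \<beta> u by simp
  let ?Q = "grid_cube k (cube_index k x)"
  have xQ: "x \<in> ?Q" by (simp add: mem_grid_cube_iff)
  have c: "norm (x - center ?Q) \<le> u"
    using grid_cube_diam[OF xQ center_in_grid_cube] by (simp add: u_def)
  have "norm (y - center ?Q) \<le> d + u"
    using norm_triangle_ineq[of "y - x" "x - center ?Q"] c by (simp add: d_def)
  moreover have "d \<le> norm (y - center ?Q) + u"
    using norm_triangle_ineq[of "y - center ?Q" "center ?Q - x"] c
    by (simp add: d_def norm_minus_commute)
  moreover have r: "81 * ?n * \<beta> / 2 ^ k = 81 * (\<beta> * u)" by (simp add: u_def)
  moreover have "y \<in> translates (bad_cone V b) ?Q"
    unfolding translates_def using xQ bad by (intro UN_I[of x] image_eqI[of _ _ "y - x"]) auto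
  ultimately have "y \<in> thin_annulus k (cube_index k x) V b \<beta>"
    unfolding thin_annulus_def r using k' bu by (auto simp: dist_norm norm_minus_commute)
  then show False using avoid k(1) by blast
qed

lemma AE_cells_pos:
  fixes M :: "(real ^ 'n) measure"
  assumes "sets M = sets borel"
  shows "AE x in M. \<forall>k. emeasure M (grid_cube k (cube_index k x)) > 0"
proof -
  have "AE x in M. emeasure M (grid_cube k j) = 0 \<longrightarrow> x \<notin> grid_cube k j" for k j
    using assms by (cases "emeasure M (grid_cube k j) = 0") (auto intro!: AE_not_in)
  then have "AE x in M. \<forall>k j. emeasure M (grid_cube k j) = 0 \<longrightarrow> x \<notin> grid_cube k j"
    by (simp add: AE_all_countable)
  then show ?thesis
    by (rule AE_mp) (auto intro!: AE_I2 simp: zero_less_iff_neq_zero mem_grid_cube_iff)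
qed

text \<open>
  For a fixed cone, the covering theorem for refining partitions is applied in each unit cube to the thin
  annuli. Each set of the resulting cover is cut into pieces contained in cubes of a small
  generation; two points of a piece do not differ by a vector of the bad cone, so the piece
  lies in a Lipschitz graph.
\<close>

lemma AE_covered_of_thin_sum:
  fixes M :: "(real ^ 'n) measure"
  assumes sets: "sets M = sets borel" and fin: "\<And>A. bounded A \<Longrightarrow> emeasure M A < \<infinity>"
    and V: "V \<in> grassmannian m" and \<beta>: "\<beta> \<ge> 5 / 6" and b: "b \<ge> 0"
  obtains \<G> where "countable \<G>" "\<G> \<subseteq> lipschitz_graphs m"
    "AE x in M. (\<Sum>k. emeasure M (thin_annulus k (cube_index k x) V b \<beta>)
       / emeasure M (grid_cube k (cube_index k x))) < \<infinity> \<longrightarrow> x \<in> \<Union>\<G>"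
proof -
  note sub = grassmannian_subspace[OF V]
  have space: "space M = UNIV" using sets_eq_imp_space_eq[OF sets] by simp
  define S where "S x = (\<Sum>k. emeasure M (thin_annulus k (cube_index k x) V b \<beta>)
       / emeasure M (grid_cube k (cube_index k x)))" for x
  have "\<exists>\<G>. countable \<G> \<and> \<G> \<subseteq> lipschitz_graphs m \<and>
    (AE x in M. x \<in> grid_cube 0 q \<longrightarrow> S x < \<infinity> \<longrightarrow> x \<in> \<Union>\<G>)" for q
  proof -
    \<comment> \<open>The covering theorem needs a finite measure. Within the unit cube of \<open>q\<close>, passing to the restriction changes no denominator and can only decrease the numerators.\<close>
    define N where "N = density M (indicator (grid_cube 0 q))"
    have setsN: "sets N = sets borel" by (simp add: N_def sets)
    have spaceN: "space N = UNIV" using sets_eq_imp_space_eq[OF setsN] by simp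
    have emN: "emeasure N A = emeasure M (grid_cube 0 q \<inter> A)" if "A \<in> sets borel" for A
    proof -
      have meas: "grid_cube 0 q \<in> sets M" "A \<in> sets M" using sets that by simp_all
      have "emeasure N A = (\<integral>\<^sup>+x. indicator (grid_cube 0 q) x * indicator A x \<partial>M)"
        unfolding N_def by (rule emeasure_density[OF borel_measurable_indicator[OF meas(1)] meas(2)])
      also have "\<dots> = (\<integral>\<^sup>+x. indicator (grid_cube 0 q \<inter> A) x \<partial>M)"
        by (rule nn_integral_cong) (rule indicator_inter_arith[symmetric])
      also have "\<dots> = emeasure M (grid_cube 0 q \<inter> A)"
        by (rule nn_integral_indicator[OF sets.Int[OF meas]])
      finally show ?thesis .
    qed
    have "emeasure N (space N) < \<infinity>"
      using emN[of UNIV] fin[OF bounded_grid_cube[of 0 q]] space by (simp add: N_def)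
    then interpret N: finite_measure N by (intro finite_measureI) auto
    interpret refining_partitions N cube_code
    proof
      show "cube_code k \<in> measurable N (count_space UNIV)" for k
        by (rule cube_code_measurable[OF setsN])
      show "cube_code k x = cube_code k y" if "cube_code (Suc k) x = cube_code (Suc k) y" for k and x y :: "real ^ 'n"
        using that cube_index_refine[of k x y] by simp
    qed
    define D where "D k n = thin_annulus k (from_nat n) V b \<beta>" for k n
    have D: "D k n \<in> sets N" for k n
      unfolding D_def setsN by (rule thin_annulus_borel[OF sub])
    obtain E :: "nat \<Rightarrow> (real ^ 'n) set" where E: "AE x in N. ratio_sum D x < \<infinity> \<longrightarrow> x \<in> (\<Union>i. E i)"
      "\<And>i. \<exists>k0. \<forall>k\<ge>k0. \<forall>x\<in>E i. \<forall>y\<in>E i. y \<notin> D k (cube_code k x)"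
      using AE_covered_by_eventually_avoiding[of D, OF D] by blast
    obtain k0 where k0: "\<And>i k x y. k \<ge> k0 i \<Longrightarrow> x \<in> E i \<Longrightarrow> y \<in> E i \<Longrightarrow> y \<notin> D k (cube_code k x)"
      using E(2) by metis
    have "\<exists>G. G \<in> lipschitz_graphs m \<and> E i \<inter> grid_cube (k0 i) l \<subseteq> G" for i l
    proof (rule subset_lipschitz_graph[OF V b])
      fix x y assume xy: "x \<in> E i \<inter> grid_cube (k0 i) l" "y \<in> E i \<inter> grid_cube (k0 i) l"
      show "y - x \<notin> bad_cone V b"
      proof (rule diff_notin_bad_cone[OF \<beta> _ _ sub])
        show "y \<notin> thin_annulus k (cube_index k x) V b \<beta>" if "k \<ge> k0 i" for k
          using k0[OF that, of x y] xy by (simp add: D_def)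
        show "norm (y - x) \<le> sqrt (real CARD('n)) / 2 ^ k0 i"
          using xy by (intro grid_cube_diam) auto
      qed
    qed auto
    then obtain G where G: "\<And>i l. G i l \<in> lipschitz_graphs m" "\<And>i l. E i \<inter> grid_cube (k0 i) l \<subseteq> G i l"
      by metis
    have cover: "(\<Union>i. E i) \<subseteq> (\<Union>i. \<Union>l. G i l)"
    proof
      fix x assume "x \<in> (\<Union>i. E i)"
      then obtain i where "x \<in> E i" by blast
      then have "x \<in> E i \<inter> grid_cube (k0 i) (cube_index (k0 i) x)" by (simp add: mem_grid_cube_iff)
      then show "x \<in> (\<Union>i. \<Union>l. G i l)" using G(2) by blast
    qed
    have "AE x in M. 0 < (indicator (grid_cube 0 q) x :: ennreal) \<longrightarrow> (ratio_sum D x < \<infinity> \<longrightarrow> x \<in> (\<Union>i. E i))"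
      using E(1) unfolding N_def by (subst (asm) AE_density) (auto intro!: borel_measurable_indicator simp: sets)
    then have "AE x in M. x \<in> grid_cube 0 q \<longrightarrow> S x < \<infinity> \<longrightarrow> x \<in> (\<Union>i. \<Union>l. G i l)"
    proof (rule AE_mp, intro AE_I2 impI)
      fix x assume x: "x \<in> space M" "0 < (indicator (grid_cube 0 q) x :: ennreal) \<longrightarrow> ratio_sum D x < \<infinity> \<longrightarrow> x \<in> (\<Union>i. E i)"
        "x \<in> grid_cube 0 q" "S x < \<infinity>"
      have "ratio_sum D x \<le> S x"
        unfolding ratio_sum_def S_def
      proof (intro suminf_le)
        fix k
        have num: "emeasure N (D k (cube_code k x)) \<le> emeasure M (thin_annulus k (cube_index k x) V b \<beta>)"
          using D[of k "cube_code k x"] sets setsN by (simp add: emN D_def emeasure_mono)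
        have "cell k (cube_code k x) = grid_cube k (cube_index k x)"
          unfolding cell_def spaceN by (auto simp: mem_grid_cube_iff)
        moreover have "grid_cube k (cube_index k x) \<subseteq> grid_cube 0 q"
        proof
          fix y assume "y \<in> grid_cube k (cube_index k x)"
          then have "cube_code k y = cube_code k x" by (simp add: mem_grid_cube_iff)
          from c_refine_le[OF this, of 0] show "y \<in> grid_cube 0 q"
            using x(3) by (simp add: mem_grid_cube_iff)
        qed
        ultimately have "emeasure N (cell k (cube_code k x)) = emeasure M (grid_cube k (cube_index k x))"
          by (simp add: emN Int_absorb1)
        then show "emeasure N (D k (cube_code k x)) / emeasure N (cell k (cube_code k x))
            \<le> emeasure M (thin_annulus k (cube_index k x) V b \<beta>) / emeasure M (grid_cube k (cube_index k x))"
          using num by (simp add: divide_right_mono_ennreal)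
      qed auto
      then have "x \<in> (\<Union>i. E i)" using x by (auto simp: order.strict_trans1)
      then show "x \<in> (\<Union>i. \<Union>l. G i l)" using cover by blast
    qed
    then show ?thesis
      using G(1) by (intro exI[of _ "range (\<lambda>(i, l). G i l)"]) (auto elim!: AE_mp)
  qed
  then obtain \<G> where "\<forall>q :: int ^ 'n. countable (\<G> q) \<and> \<G> q \<subseteq> lipschitz_graphs m \<and>
    (AE x in M. x \<in> grid_cube 0 q \<longrightarrow> S x < \<infinity> \<longrightarrow> x \<in> \<Union>(\<G> q))"
    using choice[of "\<lambda>q \<G>. countable \<G> \<and> \<G> \<subseteq> lipschitz_graphs m \<and>
      (AE x in M. x \<in> grid_cube 0 q \<longrightarrow> S x < \<infinity> \<longrightarrow> x \<in> \<Union>\<G>)"] by blast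
  then have \<G>: "\<And>q. countable (\<G> q)" "\<And>q. \<G> q \<subseteq> lipschitz_graphs m"
    "\<And>q. AE x in M. x \<in> grid_cube 0 q \<longrightarrow> S x < \<infinity> \<longrightarrow> x \<in> \<Union>(\<G> q)" by blast+
  show ?thesis
  proof
    show "countable (\<Union>q. \<G> q)" using \<G>(1) by simp
    show "(\<Union>q. \<G> q) \<subseteq> lipschitz_graphs m" using \<G>(2) by blast
    have "AE x in M. \<forall>q. x \<in> grid_cube 0 q \<longrightarrow> S x < \<infinity> \<longrightarrow> x \<in> \<Union>(\<G> q)"
      using \<G>(3) by (simp add: AE_all_countable)
    then show "AE x in M. (\<Sum>k. emeasure M (thin_annulus k (cube_index k x) V b \<beta>)
       / emeasure M (grid_cube k (cube_index k x))) < \<infinity> \<longrightarrow> x \<in> \<Union>(\<Union>q. \<G> q)"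
      unfolding S_def[symmetric]
      by (rule AE_mp) (auto intro!: AE_I2 simp: mem_grid_cube_iff)
  qed
qed


text \<open>
  The plane \<open>V\<close> and the opening \<open>\<alpha>\<close> of the cone may depend on the point. They are replaced by parameters
  from a countable set \<open>P\<close> whose thin annuli lie in the conical annuli of \<open>X(V, \<alpha>)\<close>, so that finiteness
  of the Dini function gives finiteness of one of countably many sums.
\<close>

lemma carried_of_finite_dini:
  fixes M :: "(real ^ 'n) measure"
  assumes sets: "sets M = sets borel" and em: "\<And>A. A \<in> sets borel \<Longrightarrow> emeasure M A = \<mu> A"
    and fin: "\<And>A. bounded A \<Longrightarrow> emeasure M A < \<infinity>"
    and dini: "AE x in M. \<exists>V\<in>grassmannian m. \<exists>\<alpha>>0. conical_dini \<mu> V \<alpha> x < \<infinity>"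
  obtains \<G> where "countable \<G>" "\<G> \<subseteq> lipschitz_graphs m" "AE x in M. x \<in> \<Union>\<G>"
proof -
  define S where "S W b \<beta> x = (\<Sum>k. emeasure M (thin_annulus k (cube_index k x) W b \<beta>)
       / emeasure M (grid_cube k (cube_index k x)))" for W b \<beta> x
  obtain \<V> :: "(real ^ 'n) set set" where \<V>: "countable \<V>" "\<V> \<subseteq> grassmannian m"
    "\<forall>V\<in>grassmannian m. \<forall>\<epsilon>>0. \<exists>W\<in>\<V>. \<forall>x. norm (proj V x - proj W x) \<le> \<epsilon> * norm x"
    by (rule countable_dense_grassmannian[of m])
  define P where "P = \<V> \<times> (UNIV :: nat set) \<times> {\<beta> \<in> \<rat>. \<beta> \<ge> (5 / 6 :: real)}"
  have "countable {\<beta> \<in> \<rat>. \<beta> \<ge> (5 / 6 :: real)}"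
    by (rule countable_subset[OF _ countable_rat]) auto
  then have P: "countable P" unfolding P_def using \<V>(1) by simp
  define covers where "covers i \<G> \<longleftrightarrow> countable \<G> \<and> \<G> \<subseteq> lipschitz_graphs m \<and>
    (case i of (W, n, \<beta>) \<Rightarrow> AE x in M. S W (real n) \<beta> x < \<infinity> \<longrightarrow> x \<in> \<Union>\<G>)"
    for \<G> and i :: "(real ^ 'n) set \<times> nat \<times> real"
  have "\<exists>\<G>. covers i \<G>" if "i \<in> P" for i
  proof -
    obtain W n \<beta> where i: "i = (W, n, \<beta>)" "W \<in> grassmannian m" "\<beta> \<ge> 5 / 6"
      using \<open>i \<in> P\<close> \<V>(2) by (auto simp: P_def)
    obtain \<G> where "countable \<G>" "\<G> \<subseteq> lipschitz_graphs m"
      "AE x in M. S W (real n) \<beta> x < \<infinity> \<longrightarrow> x \<in> \<Union>\<G>"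
      unfolding S_def using AE_covered_of_thin_sum[OF sets fin i(2,3), of "real n"] by auto
    then have "covers i \<G>" by (simp add: covers_def i(1))
    then show ?thesis by blast
  qed
  then obtain \<G> where "\<And>i. i \<in> P \<Longrightarrow> covers i (\<G> i)" by metis
  then have \<G>: "\<And>W n \<beta>. (W, n, \<beta>) \<in> P \<Longrightarrow> countable (\<G> (W, n, \<beta>))"
    "\<And>W n \<beta>. (W, n, \<beta>) \<in> P \<Longrightarrow> \<G> (W, n, \<beta>) \<subseteq> lipschitz_graphs m"
    "\<And>W n \<beta>. (W, n, \<beta>) \<in> P \<Longrightarrow> AE x in M. S W (real n) \<beta> x < \<infinity> \<longrightarrow> x \<in> \<Union>(\<G> (W, n, \<beta>))"
    unfolding covers_def by fastforce+
  have "AE x in M. \<forall>(W, n, \<beta>)\<in>P. S W (real n) \<beta> x < \<infinity> \<longrightarrow> x \<in> \<Union>(\<G> (W, n, \<beta>))"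
    using \<G>(3) by (subst AE_ball_countable[OF P]) auto
  with AE_cells_pos[OF sets] dini have "AE x in M. x \<in> \<Union>(\<Union>i\<in>P. \<G> i)"
  proof eventually_elim
    case (elim x)
    then obtain V \<alpha> where V: "V \<in> grassmannian m" "\<alpha> > 0" "conical_dini \<mu> V \<alpha> x < \<infinity>" by blast
    have \<epsilon>: "1 / (4 * (1 + \<alpha>)) > 0" using V(2) by simp
    obtain W where W: "W \<in> \<V>" "\<And>x. norm (proj V x - proj W x) \<le> 1 / (4 * (1 + \<alpha>)) * norm x"
      using \<V>(3) V(1) \<epsilon> by blast
    define n where "n = nat \<lceil>max 1 (2 * \<alpha>)\<rceil>"
    have n: "real n \<ge> 1" "real n \<ge> 2 * \<alpha>" unfolding n_def by linarith+
    have m1: "max \<alpha> (1 / \<alpha>) \<ge> 1" using V(2) by (cases "\<alpha> \<ge> 1") (auto simp: le_max_iff_disj)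
    then obtain \<beta> where \<beta>: "\<beta> \<in> \<rat>" "5 / 6 * max \<alpha> (1 / \<alpha>) < \<beta>" "\<beta> < max \<alpha> (1 / \<alpha>)"
      using Rats_dense_in_real[of "5 / 6 * max \<alpha> (1 / \<alpha>)" "max \<alpha> (1 / \<alpha>)"] by auto
    have mem: "(W, n, \<beta>) \<in> P" using W(1) \<beta> m1 by (auto simp: P_def)
    have sub: "subspace V" "subspace W" using V(1) W(1) \<V>(2) grassmannian_subspace by blast+
    have cone: "bad_cone W (real n) \<subseteq> bad_cone V \<alpha>"
      by (rule bad_cone_subset_of_close[OF sub V(2) n W(2)])
    have "S W (real n) \<beta> x \<le> conical_dini \<mu> V \<alpha> x"
      unfolding S_def conical_dini_eq_suminf
    proof (intro suminf_le)
      fix k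
      let ?j = "cube_index k x"
      have "thin_annulus k ?j W (real n) \<beta> \<subseteq> \<Union>(defect_cubes (grid_cube k ?j) V \<alpha>)"
        using thin_annulus_subset[OF cone] conical_annulus_subset_defect_cubes \<beta> by (meson less_imp_le order_trans)
      then have "emeasure M (thin_annulus k ?j W (real n) \<beta>) \<le> emeasure M (\<Union>(defect_cubes (grid_cube k ?j) V \<alpha>))"
        using sets by (intro emeasure_mono) auto
      then show "emeasure M (thin_annulus k ?j W (real n) \<beta>) / emeasure M (grid_cube k ?j)
          \<le> conical_defect \<mu> (grid_cube k ?j) V \<alpha>"
        using elim(1) by (simp add: conical_defect_grid_cube[OF sets em] divide_right_mono_ennreal)
    qed auto
    then have "S W (real n) \<beta> x < \<infinity>" using V(3) by (rule le_less_trans)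
    then have "x \<in> \<Union>(\<G> (W, n, \<beta>))" using elim(3) mem by blast
    then show ?case using mem by blast
  qed
  moreover have "countable (\<Union>i\<in>P. \<G> i)" using P \<G>(1) by (intro countable_UN) auto
  moreover have "(\<Union>i\<in>P. \<G> i) \<subseteq> lipschitz_graphs m" using \<G>(2) by fastforce
  ultimately show ?thesis using that by blast
qed

section \<open>Finiteness of the Dini function on graphs\<close>

text \<open>
  For the cone with \<open>\<alpha> = 4 * L\<close>, the cubes of the conical annulus of a cube that meets the graph are at a
  distance from the graph that is comparable to their side. Up to errors of a few cube diameters \<open>u\<close>,
  the vector from \<open>q\<close> to \<open>y\<close> lies in the bad cone and has length at least \<open>27 * \<alpha> * u\<close>, which is a large
  multiple of \<open>L * u\<close>; the vector from \<open>q\<close> to a point \<open>g\<close> of the graph has slope at most \<open>L\<close>. The part of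
  \<open>y - q\<close> orthogonal to \<open>V\<close> can thus only be matched if \<open>y - g\<close> is large. The constant 332 bounds the outer radius \<open>324 * L * u\<close> of the
  annulus together with the cube diameters.
\<close>

lemma graph_point_dist_defect_cubes:
  fixes V :: "(real ^ 'n) set"
  assumes V: "V \<in> grassmannian m" and f: "f ` V \<subseteq> V\<^sup>\<bottom>" "L-lipschitz_on V f" and L: "L \<ge> 1"
    and \<Gamma>: "\<Gamma> = {x + f x | x. x \<in> V}"
    and q: "q \<in> \<Gamma>" "q \<in> grid_cube k j"
    and y: "y \<in> \<Union>(defect_cubes (grid_cube k j) V (4 * L))"
  shows "g \<in> \<Gamma> \<Longrightarrow> 1 / 2 ^ k \<le> norm (y - g)"
    and "norm (y - q) \<le> 332 * sqrt (real CARD('n)) * L / 2 ^ k"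
proof -
  note sub = grassmannian_subspace[OF V]
  let ?P = "proj V" and ?Q = "grid_cube k j"
  let ?c = "center ?Q"
  define u where "u = sqrt (real CARD('n)) / 2 ^ k"
  have u: "1 / 2 ^ k \<le> u" unfolding u_def by (intro divide_right_mono) auto
  then have u0: "u > 0" by (smt (verit) zero_less_divide_1_iff zero_less_power)
  obtain i where i: "y \<in> grid_cube k i" "grid_cube k i \<inter> conical_annulus ?Q V (4 * L) \<noteq> {}"
    using y unfolding defect_cubes_grid_cube by auto
  then obtain z where z: "z \<in> grid_cube k i" "z \<in> conical_annulus ?Q V (4 * L)" by blast
  obtain p where p: "p \<in> ?Q" "z - p \<in> bad_cone V (4 * L)"
    using z(2) by (auto simp: conical_annulus_def translates_def)
  have "1 / (4 * L) \<le> 1" using L by simp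
  then have mx: "max (4 * L) (1 / (4 * L)) = 4 * L" using L by (intro max_absorb1) linarith
  have r: "defect_radius ?Q (4 * L) = 324 * (L * u)"
    unfolding defect_radius_def mx side_grid_cube by (simp add: u_def)
  have zc: "norm (z - ?c) \<le> 324 * (L * u)" "108 * (L * u) \<le> norm (z - ?c)"
    using z(2) r by (auto simp: conical_annulus_def dist_norm norm_minus_commute)
  have Lu: "u \<le> L * u" using L u0 by simp
  have diam: "norm (y - z) \<le> u" "norm (p - q) \<le> u" "norm (p - ?c) \<le> u" "norm (q - ?c) \<le> u"
    unfolding u_def using i(1) z(1) p(1) q(2) center_in_grid_cube by (blast intro: grid_cube_diam)+
  have "norm (y - q) \<le> norm (y - z) + norm (z - ?c) + norm (q - ?c)"
    using norm_triangle_ineq[of "y - z" "z - q"] norm_triangle_ineq4[of "z - ?c" "q - ?c"] by simp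
  then show "norm (y - q) \<le> 332 * sqrt (real CARD('n)) * L / 2 ^ k"
    using diam zc Lu u0 by (simp add: u_def mult_ac)
  define v where "v = z - p"
  define w where "w = y - q"
  have wv: "norm (w - v) \<le> 2 * u"
    using norm_triangle_ineq[of "y - z" "p - q"] diam by (simp add: w_def v_def algebra_simps)
  have v: "108 * (L * u) - u \<le> norm v"
    using norm_triangle_ineq[of "z - p" "p - ?c"] zc diam by (simp add: v_def)
  have cone: "4 * (L * norm (?P v)) < norm (v - ?P v)"
    using p(2) by (simp add: v_def mem_bad_cone_iff[OF sub])
  have "norm (?P v) \<le> L * norm (?P v)" using L by (simp add: mult_le_cancel_right1)
  then have v': "80 * (L * u) \<le> norm (v - ?P v)"
    using norm_le_proj[OF sub, of v] v cone Lu u0 by linarith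
  have "norm (?P w) \<le> norm (?P v) + norm (?P (w - v))"
    using norm_triangle_ineq[of "?P v" "?P (w - v)"] by (simp add: proj_diff[OF sub])
  then have "norm (?P w) \<le> norm (?P v) + 2 * u"
    using norm_proj_le[OF sub, of "w - v"] wv by linarith
  then have Pw: "L * norm (?P w) \<le> L * (norm (?P v) + 2 * u)"
    using L by (intro mult_left_mono) auto
  have "norm (v - ?P v) \<le> norm (w - ?P w) + norm ((w - v) - ?P (w - v))"
    using norm_triangle_ineq4[of "w - ?P w" "(w - v) - ?P (w - v)"] by (simp add: proj_diff[OF sub])
  then have Ww: "norm (v - ?P v) \<le> norm (w - ?P w) + 2 * u"
    using norm_diff_proj_le[OF sub, of "w - v"] wv by linarith
  have proj_graph: "?P (x + f x) = x" if "x \<in> V" for x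
    using that f(1) by (intro proj_unique[OF sub]) auto
  show "1 / 2 ^ k \<le> norm (y - g)" if g: "g \<in> \<Gamma>"
  proof -
    define h where "h = g - q"
    define t where "t = norm (y - g)"
    have "norm (h - ?P h) \<le> L * norm (?P h)"
    proof -
      obtain a b where ab: "a \<in> V" "b \<in> V" "g = a + f a" "q = b + f b"
        using g q(1) \<Gamma> by blast
      have "?P h = a - b" "h - ?P h = f a - f b"
        unfolding h_def proj_diff[OF sub] ab(3,4) proj_graph[OF ab(1)] proj_graph[OF ab(2)] by simp_all
      then show ?thesis
        using lipschitz_onD[OF f(2) ab(1,2)] by (simp add: dist_norm)
    qed
    moreover have "norm (?P h) \<le> norm (?P w) + t"
      using norm_triangle_ineq4[of "?P w" "?P (y - g)"] norm_proj_le[OF sub, of "y - g"]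
      by (simp add: h_def w_def t_def proj_diff[OF sub])
    then have "L * norm (?P h) \<le> L * (norm (?P w) + t)"
      using L by (intro mult_left_mono) auto
    moreover have "w - ?P w = (h - ?P h) + ((y - g) - ?P (y - g))"
      by (simp add: h_def w_def proj_diff[OF sub])
    then have "norm (w - ?P w) \<le> norm (h - ?P h) + t"
      using norm_triangle_ineq[of "h - ?P h" "(y - g) - ?P (y - g)"] norm_diff_proj_le[OF sub, of "y - g"]
      unfolding t_def by simp
    moreover have "t \<le> L * t" using L by (simp add: t_def mult_le_cancel_right1)
    moreover have "L * (2 * u) = 2 * (L * u)" by simp
    ultimately have "2 * (L * u) \<le> 2 * (L * t)"
      using Pw Ww cone v' Lu u0 unfolding distrib_left by linarith
    then have "u \<le> t" using L by simp
    with u show ?thesis by (simp add: t_def)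
  qed
qed

text \<open>
  A point \<open>y\<close> at distance \<open>d\<close> from the graph is in an annular region of generation \<open>k\<close> only if
  \<open>1 / 2 ^ k \<le> d \<le> C / 2 ^ k\<close>. This allows boundedly many generations, and in each of them only the
  cubes within distance \<open>C / 2 ^ k\<close> of \<open>y\<close> count, whose number is bounded as well.
\<close>

lemma defect_cubes_overlap:
  fixes V :: "(real ^ 'n) set"
  assumes V: "V \<in> grassmannian m" and f: "f ` V \<subseteq> V\<^sup>\<bottom>" "L-lipschitz_on V f" and L: "L \<ge> 1"
    and \<Gamma>: "\<Gamma> = {x + f x | x. x \<in> V}"
  obtains K R where
    "\<And>y. (\<Sum>k. \<Sum>n. indicator (cube_code k ` (\<Gamma> \<inter> cball 0 \<rho>)) n *
       indicator (\<Union>(defect_cubes (grid_cube k (from_nat n)) V (4 * L))) y) \<le> ennreal K * indicator (cball 0 R) y"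
proof -
  define C where "C = 332 * sqrt (real CARD('n)) * L"
  have C: "C \<ge> 0" using L by (simp add: C_def)
  obtain p where p: "C < 2 ^ p" using real_arch_pow[of 2 C] by auto
  define N where "N = card {j :: int ^ 'n. \<forall>i. \<bar>j $ i\<bar> \<le> \<lceil>C\<rceil> + 1}"
  define U where "U k q = \<Union>(defect_cubes (grid_cube k (cube_index k q)) V (4 * L))" for k q
  have far: "1 / 2 ^ k \<le> norm (y - g)" and near: "norm (y - q) \<le> C / 2 ^ k"
    if "y \<in> U k q" "q \<in> \<Gamma>" "g \<in> \<Gamma>" for k q y g
    using graph_point_dist_defect_cubes[OF V f L \<Gamma> that(2) _ that(1)[unfolded U_def]] that(3)
    by (auto simp: mem_grid_cube_iff C_def)
  have bound: "(\<Sum>k. \<Sum>n. indicator (cube_code k ` (\<Gamma> \<inter> cball 0 \<rho>)) n *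
       indicator (\<Union>(defect_cubes (grid_cube k (from_nat n)) V (4 * L))) y)
      \<le> ennreal (real ((p + 1) * N)) * indicator (cball 0 (\<rho> + C)) y" for y
  proof -
    let ?J = "\<lambda>k. cube_code k ` (\<Gamma> \<inter> cball 0 \<rho>)"
    let ?D = "\<lambda>k n. \<Union>(defect_cubes (grid_cube k (from_nat n)) V (4 * L))"
    define T where "T = {k. \<exists>q\<in>\<Gamma> \<inter> cball 0 \<rho>. y \<in> U k q}"
    have T: "k \<in> T" if n: "n \<in> ?J k" and yD: "y \<in> ?D k n" for k n
    proof -
      obtain q where "q \<in> \<Gamma> \<inter> cball 0 \<rho>" "n = cube_code k q" using n by blast
      with yD have "q \<in> \<Gamma> \<inter> cball 0 \<rho>" "y \<in> U k q" by (simp_all add: U_def)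
      then show ?thesis unfolding T_def by blast
    qed
    have notT: "(\<Sum>n. indicator (?J k) n * indicator (?D k n) y :: ennreal) = 0" if "k \<notin> T" for k
    proof -
      have zero: "indicator (?J k) n * indicator (?D k n) y = (0 :: ennreal)" for n
        using T[of n k] that by (auto simp: indicator_def)
      show ?thesis by (simp only: zero suminf_zero)
    qed
    have inner: "(\<Sum>n. indicator (?J k) n * indicator (?D k n) y :: ennreal) \<le> of_nat N" for k
    proof -
      define F where "F = to_nat ` {j :: int ^ 'n. \<forall>i. \<bar>j $ i - cube_index k y $ i\<bar> \<le> \<lceil>C\<rceil> + 1}"
      have F: "finite F" unfolding F_def by (intro finite_imageI finite_index_box_around)
      have cF: "card F \<le> N"
        unfolding F_def N_def card_index_box_around[where a = "cube_index k y", symmetric]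
        by (intro card_image_le finite_index_box_around)
      have out: "indicator (?J k) n * indicator (?D k n) y = (0 :: ennreal)" if "n \<notin> F" for n
      proof (rule ccontr)
        assume "indicator (?J k) n * indicator (?D k n) y \<noteq> (0 :: ennreal)"
        then have n: "n \<in> ?J k" and yD: "y \<in> ?D k n" by (auto simp: indicator_def split: if_splits)
        obtain q where q: "q \<in> \<Gamma>" "n = cube_code k q" using n by blast
        have "y \<in> U k q" using yD q(2) by (simp add: U_def)
        note q = q this
        have "norm (q - y) \<le> C / 2 ^ k" using near[OF q(3,1,1)] by (simp add: norm_minus_commute)
        from cube_index_diff_le[OF this] have "n \<in> F" using q(2) by (auto simp: F_def)
        with that show False by simp
      qed
      have "(\<Sum>n. indicator (?J k) n * indicator (?D k n) y :: ennreal) = (\<Sum>n\<in>F. indicator (?J k) n * indicator (?D k n) y)"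
        using out by (intro suminf_finite F) auto
      also have "\<dots> \<le> (\<Sum>n\<in>F. 1)"
        by (intro sum_mono) (auto simp: indicator_def)
      also have "\<dots> \<le> of_nat N" using cF by simp
      finally show ?thesis .
    qed
    show ?thesis
    proof (cases "T = {}")
      case True
      then show ?thesis using notT by simp
    next
      case False
      define k0 where "k0 = (LEAST k. k \<in> T)"
      have k0: "k0 \<in> T" unfolding k0_def using False by (auto intro: LeastI)
      then obtain q0 where q0: "q0 \<in> \<Gamma>" "norm q0 \<le> \<rho>" "y \<in> U k0 q0" by (auto simp: T_def)
      \<comment> \<open>Comparing the lower bound at the generation \<open>k0\<close> with the upper bound at \<open>k\<close>.\<close>
      have sub: "T \<subseteq> {k0..k0 + p}"
      proof
        fix k assume k: "k \<in> T"
        then have "k0 \<le> k" unfolding k0_def by (rule Least_le)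
        obtain q where q: "q \<in> \<Gamma>" "y \<in> U k q" using k by (auto simp: T_def)
        have "1 / 2 ^ k0 \<le> C / 2 ^ k"
          using far[OF q0(3,1) q(1)] near[OF q(2,1,1)] by linarith
        then have "(2::real) ^ k \<le> C * 2 ^ k0" by (simp add: field_simps)
        also have "\<dots> < 2 ^ p * 2 ^ k0" using p by (intro mult_strict_right_mono) auto
        finally have "(2::real) ^ k < 2 ^ (p + k0)" by (simp add: power_add)
        then have "k < p + k0" by simp
        with \<open>k0 \<le> k\<close> show "k \<in> {k0..k0 + p}" by simp
      qed
      have "C / 2 ^ k0 \<le> C / 1" using C by (intro divide_left_mono) auto
      then have "norm y \<le> \<rho> + C"
        using near[OF q0(3,1,1)] q0(2) norm_triangle_ineq[of "y - q0" q0] by simp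
      then have y: "y \<in> cball 0 (\<rho> + C)" by simp
      have "(\<Sum>k. \<Sum>n. indicator (?J k) n * indicator (?D k n) y :: ennreal) = (\<Sum>k\<in>{k0..k0 + p}. \<Sum>n. indicator (?J k) n * indicator (?D k n) y)"
        using sub by (intro suminf_finite notT) auto
      also have "\<dots> \<le> (\<Sum>k\<in>{k0..k0 + p}. of_nat N)"
        by (intro sum_mono inner)
      also have "\<dots> = ennreal (real ((p + 1) * N))"
        unfolding ennreal_of_nat_eq_real_of_nat[symmetric] by (simp add: algebra_simps)
      finally show ?thesis using y by simp
    qed
  qed
  show ?thesis by (rule that) (rule bound)
qed

text \<open>
  On a single graph one cone works at almost all points. The part of the graph in a ball is
  treated first, since the overlap bound needs a region of finite measure.
\<close>

lemma AE_finite_dini_on_graph: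
  fixes M :: "(real ^ 'n) measure"
  assumes sets: "sets M = sets borel" and em: "\<And>A. A \<in> sets borel \<Longrightarrow> emeasure M A = \<mu> A"
    and fin: "\<And>A. bounded A \<Longrightarrow> emeasure M A < \<infinity>"
    and \<Gamma>: "\<Gamma> \<in> lipschitz_graphs m"
  shows "AE x in M. x \<in> \<Gamma> \<longrightarrow> (\<exists>V\<in>grassmannian m. \<exists>\<alpha>>0. conical_dini \<mu> V \<alpha> x < \<infinity>)"
proof -
  have space: "space M = UNIV" using sets_eq_imp_space_eq[OF sets] by simp
  obtain V f L0 where V: "V \<in> grassmannian m" and f: "f ` V \<subseteq> V\<^sup>\<bottom>" and L0: "L0-lipschitz_on V f"
    and eq: "\<Gamma> = {x + f x | x. x \<in> V}"
    using \<Gamma> by (auto simp: lipschitz_graphs_def)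
  define L where "L = max L0 1"
  have L: "L-lipschitz_on V f" "L \<ge> 1"
    using lipschitz_on_le[OF L0, of L] by (auto simp: L_def)
  let ?D = "\<lambda>k n. \<Union>(defect_cubes (grid_cube k (from_nat n)) V (4 * L))"
  have "AE x in M. x \<in> \<Gamma> \<inter> cball 0 (real \<rho>) \<longrightarrow> conical_dini \<mu> V (4 * L) x < \<infinity>" for \<rho> :: nat
  proof -
    obtain K R where KR: "\<And>y. (\<Sum>k. \<Sum>n. indicator (cube_code k ` (\<Gamma> \<inter> cball 0 (real \<rho>))) n * indicator (?D k n) y) \<le> ennreal K * indicator (cball 0 R) y"
      using defect_cubes_overlap[OF V f L eq] by blast
    have "AE x in M. (\<forall>k. cube_code k x \<in> cube_code k ` (\<Gamma> \<inter> cball 0 (real \<rho>))) \<longrightarrow>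
      (\<Sum>k. emeasure M (?D k (cube_code k x)) / emeasure M {y \<in> space M. cube_code k y = cube_code k x}) < \<infinity>"
      by (rule AE_summable_ratio_of_finite_overlap[where D = ?D, OF cube_code_measurable[OF sets] _ KR])
        (use sets fin in auto)
    then show ?thesis
    proof (rule AE_mp, intro AE_I2 impI)
      fix x assume x: "(\<forall>k. cube_code k x \<in> cube_code k ` (\<Gamma> \<inter> cball 0 (real \<rho>))) \<longrightarrow>
        (\<Sum>k. emeasure M (?D k (cube_code k x)) / emeasure M {y \<in> space M. cube_code k y = cube_code k x}) < \<infinity>"
        "x \<in> \<Gamma> \<inter> cball 0 (real \<rho>)"
      have "conical_dini \<mu> V (4 * L) x \<le>
        (\<Sum>k. emeasure M (?D k (cube_code k x)) / emeasure M {y \<in> space M. cube_code k y = cube_code k x})"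
        unfolding conical_dini_eq_suminf
      proof (intro suminf_le)
        fix k
        have "{y \<in> space M. cube_code k y = cube_code k x} = grid_cube k (cube_index k x)"
          by (auto simp: space mem_grid_cube_iff)
        then show "conical_defect \<mu> (grid_cube k (cube_index k x)) V (4 * L) \<le>
          emeasure M (?D k (cube_code k x)) / emeasure M {y \<in> space M. cube_code k y = cube_code k x}"
          by (simp add: conical_defect_grid_cube[OF sets em])
      qed auto
      then show "conical_dini \<mu> V (4 * L) x < \<infinity>"
        using x by (meson image_eqI le_less_trans)
    qed
  qed
  then have "AE x in M. \<forall>\<rho> :: nat. x \<in> \<Gamma> \<inter> cball 0 (real \<rho>) \<longrightarrow> conical_dini \<mu> V (4 * L) x < \<infinity>"
    unfolding AE_all_countable by (rule allI)
  then show ?thesis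
  proof (rule AE_mp, intro AE_I2 impI)
    fix x assume x: "\<forall>\<rho> :: nat. x \<in> \<Gamma> \<inter> cball 0 (real \<rho>) \<longrightarrow> conical_dini \<mu> V (4 * L) x < \<infinity>" "x \<in> \<Gamma>"
    obtain \<rho> :: nat where "norm x \<le> real \<rho>" using real_arch_simple by blast
    then have "conical_dini \<mu> V (4 * L) x < \<infinity>" using x by auto
    moreover have "4 * L > 0" using L by simp
    ultimately show "\<exists>V\<in>grassmannian m. \<exists>\<alpha>>0. conical_dini \<mu> V \<alpha> x < \<infinity>" using V by blast
  qed
qed

section \<open>The characterization\<close>

lemma lipschitz_graphs_nonempty:
  assumes "m \<le> DIM('a :: euclidean_space)"
  shows "(lipschitz_graphs m :: 'a set set) \<noteq> {}"
proof -
  obtain V :: "'a set" where V: "subspace V" "dim V = m"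
    using choose_subspace_of_subspace[of m "UNIV :: 'a set"] assms by auto
  have f: "(\<lambda>_. 0) ` V \<subseteq> V\<^sup>\<bottom>" "\<exists>L. L-lipschitz_on V (\<lambda>_. 0 :: 'a)"
    by (auto simp: subspace_0 subspace_orthogonal_comp intro!: exI[of _ 0] lipschitz_onI)
  have "V \<in> grassmannian m" using V by (simp add: grassmannian_def)
  with f have "{x + (\<lambda>_. 0) x | x. x \<in> V} \<in> lipschitz_graphs m"
    unfolding lipschitz_graphs_def by (intro CollectI exI[of _ V] exI[of _ "\<lambda>_. 0"] conjI refl)
  then show ?thesis by (metis empty_iff)
qed

theorem corollary1p6:
  fixes \<mu> :: "(real ^ 'n) set \<Rightarrow> ennreal" and m :: nat
  assumes "1 \<le> m" and "m \<le> CARD('n) - 1"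
    and "radon_measure \<mu>"
  shows "carried_by \<mu> (lipschitz_graphs m) \<longleftrightarrow>
    \<mu> {x. \<not> (\<exists>V\<in>grassmannian m. \<exists>\<alpha>>0. conical_dini \<mu> V \<alpha> x < \<infinity>)} = 0"
proof -
  obtain M where sets: "sets M = sets borel"
    and em: "\<And>A. A \<in> sets borel \<Longrightarrow> emeasure M A = \<mu> A"
    and ae: "\<And>P. (AE x in M. P x) \<longleftrightarrow> \<mu> {x. \<not> P x} = 0"
    and fin: "\<And>A. bounded A \<Longrightarrow> emeasure M A < \<infinity>"
    using radon_measure_obtain_borel[OF assms(3)] by auto
  let ?good = "\<lambda>x. \<exists>V\<in>grassmannian m. \<exists>\<alpha>>0. conical_dini \<mu> V \<alpha> x < \<infinity>"
  have carried: "\<mu> (UNIV - (\<Union>i. F i)) = 0 \<longleftrightarrow> (AE x in M. x \<in> (\<Union>i. F i))" for F :: "nat \<Rightarrow> (real ^ 'n) set"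
    unfolding ae by (simp add: set_diff_eq)
  have "carried_by \<mu> (lipschitz_graphs m) \<longleftrightarrow> (AE x in M. ?good x)"
  proof
    assume "carried_by \<mu> (lipschitz_graphs m)"
    then obtain F :: "nat \<Rightarrow> (real ^ 'n) set" where F: "\<And>i. F i \<in> lipschitz_graphs m"
      and AE_F: "AE x in M. x \<in> (\<Union>i. F i)"
      unfolding carried_by_def carried by blast
    have "AE x in M. \<forall>i. x \<in> F i \<longrightarrow> ?good x"
      unfolding AE_all_countable using AE_finite_dini_on_graph[OF sets em fin F] by blast
    with AE_F show "AE x in M. ?good x"
      by eventually_elim blast
  next
    assume "AE x in M. ?good x"
    then obtain \<G> where \<G>: "countable \<G>" "\<G> \<subseteq> lipschitz_graphs m" "AE x in M. x \<in> \<Union>\<G>"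
      using carried_of_finite_dini[OF sets em fin] by auto
    have "m \<le> DIM(real ^ 'n)" using assms(2) by simp
    from lipschitz_graphs_nonempty[OF this] obtain G0 :: "(real ^ 'n) set"
      where G0: "G0 \<in> lipschitz_graphs m" by (metis ex_in_conv)
    \<comment> \<open>\<open>\<G>\<close> may be empty if \<open>\<mu> = 0\<close>, while a sequence of graphs needs at least one.\<close>
    define F where "F = from_nat_into (insert G0 \<G>)"
    have range: "range F = insert G0 \<G>"
      unfolding F_def by (rule range_from_nat_into) (use \<G>(1) in auto)
    have "range F \<subseteq> lipschitz_graphs m" using range G0 \<G>(2) by auto
    moreover have "AE x in M. x \<in> (\<Union>i. F i)"
      using \<G>(3) by (rule AE_mp) (auto intro!: AE_I2 simp: range)
    ultimately show "carried_by \<mu> (lipschitz_graphs m)"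
      unfolding carried_by_def carried by blast
  qed
  then show ?thesis unfolding ae .
qed

end
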